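(* Let $\mathcal P,\mathcal Q$ be two matroids on the same finite ground set $V$, and let $\mathcal D=\mathcal P\cap\mathcal Q$ (i.e. $A\in\mathcal D$ iff $A\in\mathcal P$ and $A\in\mathcal Q$). Let $n=|V|$, $\zeta=\max(\zeta(\mathcal P),\zeta(\mathcal Q))$ and $\delta_{\zeta,n}=\frac{1}{\zeta}-\frac{1}{n}$. Then for every partition $(A,B)$ of $V$ into two sets there exists a set $S\in\mathcal D$ such that $|S\cap A|\ge\lfloor\delta_{\zeta,n}|A|\rfloor-1$ and $|S\cap B|\ge\lfloor\delta_{\zeta,n}|B|\rfloor-1$.
   Context: A simplicial complex $\mathcal C$ on a ground set $V(\mathcal C)$ is a family of subsets (edges) closed under taking subsets. A matroid is a complex in which, for every subset $W$ of the ground set, all maximal edges contained in $W$ have the same size. For a complex $\mathcal C$, $\mathrm{rank}(\mathcal C)$ is the maximal size of an edge of $\mathcal C$, $\mathcal C[S]$ is the set of edges of $\mathcal C$ contained in $S$, and $\zeta(\mathcal C)=\max_{S\subseteq V(\mathcal C)}\frac{|S|}{\mathrm{rank}(\mathcal C[S])}$ (over nonempty $S$). A set $S$ represents a set $A$ almost $\alpha$-fairly if $|S\cap A|\ge\lfloor\alpha|A|\rfloor-1$; the claim says a set of $\mathcal D$ represents both parts almost $\delta_{\zeta,n}$-fairly. *)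

theory Defs
  imports Complex_Main "HOL-Library.Extended_Real"
begin

definition complex :: "'a set \<Rightarrow> 'a set set \<Rightarrow> bool" where
  "complex V C \<longleftrightarrow> C \<subseteq> Pow V \<and> (\<forall>E\<in>C. \<forall>F. F \<subseteq> E \<longrightarrow> F \<in> C)"

definition maximal_in :: "'a set set \<Rightarrow> 'a set \<Rightarrow> 'a set \<Rightarrow> bool" where
  "maximal_in C W X \<longleftrightarrow> X \<in> C \<and> X \<subseteq> W \<and> (\<forall>Z\<in>C. X \<subseteq> Z \<and> Z \<subseteq> W \<longrightarrow> Z = X)"

definition matroid :: "'a set \<Rightarrow> 'a set set \<Rightarrow> bool" where
  "matroid V C \<longleftrightarrow> complex V C \<and> {} \<in> C \<and>
     (\<forall>W. W \<subseteq> V \<longrightarrow> (\<forall>X Y. maximal_in C W X \<and> maximal_in C W Y \<longrightarrow> card X = card Y))"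

definition rank_on :: "'a set set \<Rightarrow> 'a set \<Rightarrow> nat" where
  "rank_on C S = Max (card ` {E \<in> C. E \<subseteq> S})"

text \<open>zeta(C) = max over nonempty S of |S| / rank(C[S]), as an extended real
  (equal to \<infinity> when some nonempty S has rank 0).\<close>
definition zeta :: "'a set \<Rightarrow> 'a set set \<Rightarrow> ereal" where
  "zeta V C = Max ((\<lambda>S. ereal (real (card S)) / ereal (real (rank_on C S))) ` {S. S \<subseteq> V \<and> S \<noteq> {}})"

end

theory Submission
  imports Defs
begin

text \<open>
  Put \<open>n = |V|\<close> and \<open>k = \<lfloor>n / \<zeta>\<rfloor>\<close>. Since \<open>|L| / \<zeta>\<close> is at most the rank of \<open>L\<close> in both matroids, the
  constant vector \<open>k / n\<close> lies in the base polytopes of both matroids truncated to rank \<open>k\<close>. Weight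
  splitting for matroid intersection then yields common independent sets \<open>S\<close> and \<open>T\<close> of size \<open>k\<close>
  with \<open>|S \<inter> A| \<ge> k |A| / n\<close> and \<open>|T \<inter> B| \<ge> k |B| / n\<close>. One moves from \<open>S\<close> to \<open>T\<close> by
  exchanges along shortest cycles of the exchange graph inside the symmetric difference. Such a cycle
  is chordless, so it can be performed one element at a time through common independent sets of
  size \<open>k - 1\<close>; the intersection with \<open>A\<close> changes by at most one in each step, and some set on the
  way meets \<open>A\<close> in \<open>\<lfloor>k |A| / n\<rfloor> - 1\<close> elements. Rounding \<open>n / \<zeta>\<close> down to \<open>k\<close> costs at most
  \<open>|A| / n\<close>, which is the correction \<open>1 / n\<close> in \<open>\<delta>\<close>.
\<close>

section \<open>Matroids of bounded rank\<close>

text \<open>The bound \<open>k\<close> need not be attained, but a member of size \<open>k\<close>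
  is a basis. With \<open>k\<close> as a parameter two matroids can share it, and their common bases
  are then the common members of size \<open>k\<close>.\<close>

locale bounded_matroid =
  fixes V :: "'b set" and M :: "'b set set" and k :: nat
  assumes finite_ground: "finite V"
    and subset_ground: "X \<in> M \<Longrightarrow> X \<subseteq> V"
    and empty_indep: "{} \<in> M"
    and indep_subset: "X \<in> M \<Longrightarrow> Y \<subseteq> X \<Longrightarrow> Y \<in> M"
    and exchange: "X \<in> M \<Longrightarrow> Y \<in> M \<Longrightarrow> card X < card Y \<Longrightarrow> \<exists>y\<in>Y - X. insert y X \<in> M"
    and card_le: "X \<in> M \<Longrightarrow> card X \<le> k"
begin

lemma finite_indep: "X \<in> M \<Longrightarrow> finite X"
  using subset_ground finite_ground finite_subset by blast

lemma extend:
  assumes "X \<in> M" "Y \<in> M" "card X \<le> card Y"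
  shows "\<exists>Z. Z \<subseteq> Y - X \<and> X \<union> Z \<in> M \<and> card (X \<union> Z) = card Y"
  using assms
proof (induction "card Y - card X" arbitrary: X)
  case 0
  then show ?case by (intro exI[of _ "{}"]) auto
next
  case (Suc d)
  then have "card X < card Y" by simp
  with Suc.prems obtain y where y: "y \<in> Y - X" "insert y X \<in> M"
    using exchange by blast
  have c: "card (insert y X) = Suc (card X)"
    using y finite_indep[OF Suc.prems(1)] by simp
  obtain Z where "Z \<subseteq> Y - insert y X" "insert y X \<union> Z \<in> M" "card (insert y X \<union> Z) = card Y"
    using Suc.hyps(1)[of "insert y X"] Suc.hyps(2) Suc.prems c y by fastforce
  then show ?case using y by (intro exI[of _ "insert y Z"]) auto
qed

text \<open>Extend \<open>insert f D\<close> by elements of \<open>S\<close> to size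
  \<open>k\<close>. The result contains all of \<open>S\<close> except one element, which lies
  outside \<open>D\<close> and serves as \<open>e\<close>.\<close>

lemma swap:
  assumes S: "S \<in> M" "card S = k" and D: "D \<subseteq> S" "f \<notin> S" "insert f D \<in> M"
  shows "\<exists>e\<in>S - D. insert f (S - {e}) \<in> M"
proof -
  have fS: "finite S" using S finite_indep by blast
  obtain Z where Z: "Z \<subseteq> S - insert f D" "insert f D \<union> Z \<in> M" "card (insert f D \<union> Z) = card S"
    using extend[OF D(3) S(1)] card_le[OF D(3)] S(2) by auto
  have sub: "D \<union> Z \<subseteq> S" using Z D by auto
  have "card (insert f (D \<union> Z)) = Suc (card (D \<union> Z))"
    using D sub fS by (intro card_insert_disjoint) (auto intro: finite_subset)
  then have "card (S - (D \<union> Z)) = 1"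
    using Z(3) sub fS finite_subset[OF sub fS] by (simp add: card_Diff_subset)
  then obtain e where e: "S - (D \<union> Z) = {e}" using card_1_singletonE by blast
  then have "insert f (S - {e}) = insert f D \<union> Z" using sub by auto
  then show ?thesis using e Z by (intro bexI[of _ e]) auto
qed

text \<open>The elements \<open>x\<close> of \<open>S\<close> with
  \<open>insert f (S - {x}) \<in> M\<close> form, together with \<open>f\<close>, the fundamental
  circuit of \<open>f\<close>. The last hypothesis keeps this circuit inside
  \<open>insert f R\<close>. Deleting \<open>e\<close> from it restores independence, and an
  extension of the rest by elements of \<open>R\<close> to a basis can never pick \<open>e\<close>,
  so it is \<open>insert f (R - {e})\<close>.\<close>

lemma swap_unblocked:
  assumes S: "S \<in> M" "card S = k" and f: "f \<notin> S" "insert f (S - {e}) \<in> M" "e \<in> S"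
    and R: "R \<in> M" "card R = k" "f \<notin> R"
    and D: "\<And>x. x \<in> S \<Longrightarrow> insert f (S - {x}) \<in> M \<Longrightarrow> x \<in> R"
  shows "insert f (R - {e}) \<in> M"
proof -
  define C where "C = {x\<in>S. insert f (S - {x}) \<in> M}"
  have CR: "C \<subseteq> R" "e \<in> C" "C \<subseteq> S" using D f by (auto simp: C_def)
  have dep: "insert f C \<notin> M"
    using swap[OF S CR(3) f(1)] by (auto simp: C_def)
  have ind: "insert f (C - {e}) \<in> M"
    using CR by (intro indep_subset[OF f(2)]) auto
  have fR: "finite R" using R finite_indep by blast
  obtain Z where Z: "Z \<subseteq> R - insert f (C - {e})" "insert f (C - {e}) \<union> Z \<in> M"
      "card (insert f (C - {e}) \<union> Z) = card R"
    using extend[OF ind R(1)] card_le[OF ind] R(2) by auto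
  have "e \<notin> Z"
  proof
    assume "e \<in> Z"
    then have "insert f C \<subseteq> insert f (C - {e}) \<union> Z" by auto
    then show False using dep Z(2) indep_subset by blast
  qed
  then have "insert f (C - {e}) \<union> Z \<subseteq> insert f (R - {e})" using Z CR by auto
  moreover have "card (insert f (R - {e})) = card R"
    using R(3) fR CR card.remove[of R e] by auto
  ultimately have "insert f (C - {e}) \<union> Z = insert f (R - {e})"
    using Z(3) fR by (intro card_subset_eq) auto
  then show ?thesis using Z by simp
qed

text \<open>Induction on the number of pairs: the pair with the largest \<open>key\<close> is
  exchanged last. By \<open>tri\<close> its \<open>f i\<close> cannot replace any other
  \<open>e j\<close>, so the fundamental circuit of \<open>f i\<close> survives the earlier
  exchanges and \<open>swap_unblocked\<close> applies.\<close>

lemma triangular_exchange: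
  fixes key :: "'i \<Rightarrow> int"
  assumes S: "S \<in> M" "card S = k" and I: "finite I"
    and e: "inj_on e I" "e ` I \<subseteq> S" and f: "inj_on f I" "f ` I \<inter> S = {}"
    and diag: "\<And>i. i \<in> I \<Longrightarrow> insert (f i) (S - {e i}) \<in> M"
    and tri: "\<And>i j. i \<in> I \<Longrightarrow> j \<in> I \<Longrightarrow> i \<noteq> j \<Longrightarrow> insert (f j) (S - {e i}) \<in> M \<Longrightarrow> key j < key i"
  shows "S - e ` I \<union> f ` I \<in> M"
  using I e f diag tri
proof (induction "card I" arbitrary: I)
  case 0
  then show ?case using S by simp
next
  case (Suc d)
  then have ne: "I \<noteq> {}" "finite I" by auto
  have "Max (key ` I) \<in> key ` I" using ne by simp
  then obtain i where i: "i \<in> I" "key i = Max (key ` I)" by force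
  have mx: "key j \<le> key i" if "j \<in> I" for j using that i ne by simp
  define J where "J = I - {i}"
  define R where "R = S - e ` J \<union> f ` J"
  have J: "J \<subseteq> I" "finite J" "d = card J" "i \<notin> J" using Suc.hyps(2) i ne by (auto simp: J_def)
  have IJ: "I = insert i J" using i J_def by auto
  have RM: "R \<in> M" unfolding R_def
  proof (rule Suc.hyps(1)[OF J(3,2)])
    show "inj_on e J" "inj_on f J" using Suc.prems J(1) by (auto intro: inj_on_subset)
    show "e ` J \<subseteq> S" "f ` J \<inter> S = {}" using Suc.prems(3,5) IJ by auto
  qed (use Suc.prems(6,7) IJ in auto)
  have fS: "finite S" using S finite_indep by blast
  have "card R = card S"
  proof -
    have "card (e ` J) = card J" "card (f ` J) = card J"
      using Suc.prems J(1) by (auto intro!: card_image intro: inj_on_subset)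
    moreover have "e ` J \<subseteq> S" "f ` J \<inter> S = {}" using Suc.prems(3,5) IJ by auto
    ultimately show ?thesis unfolding R_def using fS J(2) card_mono[OF fS, of "e ` J"]
      by (subst card_Un_disjoint) (auto simp: card_Diff_subset)
  qed
  then have cR: "card R = k" using S by simp
  have fi: "f i \<notin> S" "e i \<in> S" "insert (f i) (S - {e i}) \<in> M" using Suc.prems i by auto
  have fR: "f i \<notin> R" using fi Suc.prems(4) IJ J(4) by (auto simp: R_def inj_on_def)
  have "insert (f i) (R - {e i}) \<in> M"
  proof (rule swap_unblocked[OF S fi(1,3,2) RM cR fR])
    fix x assume x: "x \<in> S" "insert (f i) (S - {x}) \<in> M"
    show "x \<in> R"
    proof (rule ccontr)
      assume "x \<notin> R"
      then obtain j where j: "j \<in> J" "x = e j" using x by (auto simp: R_def)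
      then have "key i < key j" using Suc.prems(7)[of j i] x i J by auto
      then show False using mx[of j] j J by auto
    qed
  qed
  moreover have "insert (f i) (R - {e i}) = S - e ` I \<union> f ` I"
    using fi Suc.prems(5) unfolding R_def IJ by auto
  ultimately show ?case by simp
qed

text \<open>The greedy principle: if \<open>X\<close> were larger, some \<open>f\<close> of
  \<open>X\<close> would augment the part of \<open>S\<close> of weight at least \<open>t\<close>,
  and \<open>swap\<close> would exchange \<open>f\<close> for an element of weight below
  \<open>t\<close>, against \<open>opt\<close>.\<close>

lemma locally_optimal_spans_level:
  fixes w :: "'b \<Rightarrow> int"
  assumes S: "S \<in> M" "card S = k"
    and opt: "\<And>e f. e \<in> S \<Longrightarrow> f \<in> V - S \<Longrightarrow> insert f (S - {e}) \<in> M \<Longrightarrow> w f \<le> w e"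
    and X: "X \<in> M" "X \<subseteq> {v\<in>V. t \<le> w v}"
  shows "card X \<le> card {v\<in>S. t \<le> w v}"
proof (rule ccontr)
  let ?D = "{v\<in>S. t \<le> w v}"
  assume "\<not> ?thesis"
  moreover have "?D \<in> M" using indep_subset[OF S(1), of ?D] by auto
  ultimately obtain f where f: "f \<in> X - ?D" "insert f ?D \<in> M" using exchange[of ?D X] X(1) by auto
  then have fS: "f \<in> V - S" "t \<le> w f" using X by auto
  then obtain e where e: "e \<in> S - ?D" "insert f (S - {e}) \<in> M"
    using swap[OF S, of ?D f] f(2) by auto
  then have "w f \<le> w e" using opt fS by blast
  then show False using e fS by auto
qed

end

section \<open>Potentials and minimal negative cycles\<close>

definition cyc :: "('b \<Rightarrow> 'b \<Rightarrow> bool) \<Rightarrow> 'b list \<Rightarrow> bool" where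
  "cyc E xs \<longleftrightarrow> xs \<noteq> [] \<and> distinct xs \<and> successively E xs \<and> E (last xs) (hd xs)"

text \<open>The shortest path potential: \<open>p v\<close> is the least weight of a simple path
  ending at \<open>v\<close>, with the weight of \<open>v\<close> included.\<close>

lemma potential_exists:
  fixes \<omega> :: "'b \<Rightarrow> int"
  assumes U: "finite U" and E: "\<And>u v. E u v \<Longrightarrow> u \<in> U \<and> v \<in> U"
    and nonneg: "\<And>xs. cyc E xs \<Longrightarrow> 0 \<le> sum_list (map \<omega> xs)"
  shows "\<exists>p :: 'b \<Rightarrow> int. \<forall>u v. E u v \<longrightarrow> p v \<le> p u + \<omega> v"
proof -
  define paths where "paths v = {xs. xs \<noteq> [] \<and> distinct xs \<and> set xs \<subseteq> U \<and> successively E xs \<and> last xs = v}" for v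
  define p where "p v = Min ((\<lambda>xs. sum_list (map \<omega> xs)) ` paths v)" for v
  have fin: "finite (paths v)" for v
  proof (rule finite_subset)
    show "paths v \<subseteq> {xs. set xs \<subseteq> U \<and> length xs \<le> card U}"
      using U by (auto simp: paths_def) (metis card_mono distinct_card)
    show "finite {xs. set xs \<subseteq> U \<and> length xs \<le> card U}"
      using finite_lists_length_le[OF U] .
  qed
  have le: "p v \<le> sum_list (map \<omega> xs)" if "xs \<in> paths v" for xs v
    using that fin by (auto simp: p_def)
  have "p v \<le> p u + \<omega> v" if uv: "E u v" for u v
  proof -
    have "[u] \<in> paths u" using E[OF uv] by (simp add: paths_def)
    then have "p u \<in> (\<lambda>xs. sum_list (map \<omega> xs)) ` paths u"
      unfolding p_def using fin by (intro Min_in) auto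
    then obtain xs where xs: "xs \<in> paths u" "p u = sum_list (map \<omega> xs)" by auto
    show ?thesis
    proof (cases "v \<in> set xs")
      case False
      then have "xs @ [v] \<in> paths v"
        using xs(1) E[OF uv] uv by (auto simp: paths_def successively_append_iff)
      then show ?thesis using le xs(2) by fastforce
    next
      case True
      \<comment> \<open>The path to \<open>u\<close> already visits \<open>v\<close>. Its part from
        \<open>v\<close> on is closed by the arc from \<open>u\<close> to \<open>v\<close> into a
        cycle of nonnegative weight, so the initial path up to \<open>v\<close> is light
        enough.\<close>
      then obtain ys zs where s: "xs = ys @ v # zs" by (meson split_list)
      have "cyc E (v # zs)"
        using xs(1) uv unfolding s by (auto simp: cyc_def paths_def successively_append_iff)
      then have "0 \<le> sum_list (map \<omega> (v # zs))" by (rule nonneg)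
      moreover have "ys @ [v] \<in> paths v"
        using xs(1) unfolding s by (auto simp: paths_def successively_append_iff successively_Cons)
      then have "p v \<le> sum_list (map \<omega> (ys @ [v]))" by (rule le)
      ultimately show ?thesis using xs(2) by (simp add: s)
    qed
  qed
  then show ?thesis by blast
qed

text \<open>Length, rather than weight, is minimised: any shorter cycle, such as one closed by a
  chord, then has nonnegative weight.\<close>

definition min_neg_cyc :: "('b \<Rightarrow> 'b \<Rightarrow> bool) \<Rightarrow> ('b \<Rightarrow> int) \<Rightarrow> 'b list \<Rightarrow> bool" where
  "min_neg_cyc E \<omega> xs \<longleftrightarrow> cyc E xs \<and> sum_list (map \<omega> xs) < 0 \<and>
     (\<forall>ys. cyc E ys \<longrightarrow> sum_list (map \<omega> ys) < 0 \<longrightarrow> length xs \<le> length ys)"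

lemma min_neg_cyc_exists:
  assumes "cyc E xs" "sum_list (map \<omega> xs) < 0"
  shows "\<exists>ys. min_neg_cyc E \<omega> ys"
proof -
  let ?P = "\<lambda>ys. cyc E ys \<and> sum_list (map \<omega> ys) < 0"
  have "?P (arg_min length ?P)" "\<forall>ys. ?P ys \<longrightarrow> length (arg_min length ?P) \<le> length ys"
    using arg_min_nat_lemma[of ?P xs length] assms by auto
  then show ?thesis unfolding min_neg_cyc_def by blast
qed

lemma cyc_rotate1: "cyc E (rotate1 xs) \<longleftrightarrow> cyc E xs"
proof (cases xs)
  case (Cons x ys)
  then show ?thesis
    by (cases ys) (auto simp: cyc_def successively_append_iff successively_Cons)
qed simp

lemma min_neg_cyc_rotate1:
  assumes "min_neg_cyc E \<omega> xs"
  shows "min_neg_cyc E \<omega> (rotate1 xs)"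
proof -
  have "sum_list (map \<omega> (rotate1 xs)) = sum_list (map \<omega> xs)" by (cases xs) auto
  then show ?thesis using assms by (simp add: min_neg_cyc_def cyc_rotate1)
qed

lemma cyc_nth:
  assumes "cyc E xs"
  shows "Suc i < length xs \<Longrightarrow> E (xs ! i) (xs ! Suc i)"
    and "E (xs ! (length xs - 1)) (xs ! 0)"
  using assms by (auto simp: cyc_def successively_conv_nth last_conv_nth hd_conv_nth)

text \<open>The chord closes the segment from position \<open>j\<close> to position \<open>i\<close>
  into a cycle. It is shorter than \<open>xs\<close>, so its weight, the difference of the two
  prefix sums, is nonnegative.\<close>

lemma min_neg_cyc_backward_chord:
  assumes xs: "min_neg_cyc E \<omega> xs" and ij: "j \<le> i" "i < length xs" "Suc i - j < length xs"
    and E: "E (xs ! i) (xs ! j)"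
  shows "sum_list (map \<omega> (take j xs)) \<le> sum_list (map \<omega> (take (Suc i) xs))"
proof -
  let ?ys = "drop j (take (Suc i) xs)"
  have c: "distinct xs" "successively E xs" using xs by (auto simp: min_neg_cyc_def cyc_def)
  have "last ?ys = xs ! i" "hd ?ys = xs ! j" "?ys \<noteq> []"
    using ij by (auto simp: last_conv_nth hd_drop_conv_nth)
  moreover have "successively E ?ys"
    using c(2) ij by (auto simp: successively_conv_nth)
  ultimately have "cyc E ?ys" using c E by (simp add: cyc_def)
  moreover have "length ?ys < length xs" using ij by simp
  ultimately have "0 \<le> sum_list (map \<omega> ?ys)" using xs by (fastforce simp: min_neg_cyc_def)
  moreover have "take (Suc i) xs = take j xs @ ?ys"
    using ij by (metis append_take_drop_id le_SucI min.absorb1 take_take)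
  ultimately show ?thesis by (metis le_add_same_cancel1 map_append sum_list_append)
qed

text \<open>The chord bypasses the positions strictly between \<open>i\<close> and \<open>j\<close>.
  The remaining vertices form a shorter cycle, which has nonnegative weight.\<close>

lemma min_neg_cyc_forward_chord:
  assumes xs: "min_neg_cyc E \<omega> xs" and ij: "Suc i < j" "j < length xs"
    and E: "E (xs ! i) (xs ! j)"
  shows "sum_list (map \<omega> (take j xs)) \<le> sum_list (map \<omega> (take (Suc i) xs)) + sum_list (map \<omega> xs)"
proof -
  let ?ys = "drop j xs @ take (Suc i) xs"
  have c: "distinct xs" "successively E xs" "E (last xs) (hd xs)" "xs \<noteq> []"
    using xs by (auto simp: min_neg_cyc_def cyc_def)
  have l: "last ?ys = xs ! i" "hd ?ys = xs ! j" "?ys \<noteq> []"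
    using ij by (auto simp: last_append take_Suc_conv_app_nth hd_append hd_drop_conv_nth)
  have "successively E (drop j xs)" "successively E (take (Suc i) xs)"
    using c(2) ij by (auto simp: successively_conv_nth)
  then have "successively E ?ys"
    using c ij by (auto simp: successively_append_iff)
  moreover have "set (drop j xs) \<inter> set (take (Suc i) xs) = {}"
    using set_take_disj_set_drop_if_distinct[OF c(1), of "Suc i" j] ij by auto
  ultimately have "cyc E ?ys" using c E l by (simp add: cyc_def)
  moreover have "length ?ys < length xs" using ij by simp
  ultimately have "0 \<le> sum_list (map \<omega> ?ys)" using xs by (fastforce simp: min_neg_cyc_def)
  moreover have "sum_list (map \<omega> xs) = sum_list (map \<omega> (take j xs)) + sum_list (map \<omega> (drop j xs))"
    by (metis append_take_drop_id map_append sum_list_append)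
  ultimately show ?thesis by simp
qed

section \<open>Exchange graphs and weight splitting\<close>

text \<open>The exchange digraph of matroid intersection. \<open>X\<close> and \<open>Y\<close>
  restrict the elements that may leave and enter \<open>S\<close>: they are \<open>S\<close> and
  \<open>V - S\<close> for weight splitting, and the two halves of a symmetric difference for moving
  between common bases.\<close>

definition exch :: "'b set set \<Rightarrow> 'b set set \<Rightarrow> 'b set \<Rightarrow> 'b set \<Rightarrow> 'b set \<Rightarrow> 'b \<Rightarrow> 'b \<Rightarrow> bool" where
  "exch M N S X Y u v \<longleftrightarrow>
     u \<in> X \<and> v \<in> Y \<and> insert v (S - {u}) \<in> M \<or> u \<in> Y \<and> v \<in> X \<and> insert u (S - {v}) \<in> N"

lemma bipartite_cyc_alternates:
  assumes xs: "cyc E xs" and XY: "X \<inter> Y = {}" and hd: "hd xs \<in> X"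
    and bip: "\<And>u v. E u v \<Longrightarrow> u \<in> X \<and> v \<in> Y \<or> u \<in> Y \<and> v \<in> X"
  shows "even (length xs)"
    and "i < length xs \<Longrightarrow> if even i then xs ! i \<in> X else xs ! i \<in> Y"
proof -
  have ne: "xs \<noteq> []" using xs by (simp add: cyc_def)
  have alt: "if even i then xs ! i \<in> X else xs ! i \<in> Y" if "i < length xs" for i
    using that
  proof (induction i)
    case 0
    then show ?case using hd ne by (simp add: hd_conv_nth)
  next
    case (Suc i)
    then show ?case using bip[OF cyc_nth(1)[OF xs, of i]] XY by (auto split: if_splits)
  qed
  then show "i < length xs \<Longrightarrow> if even i then xs ! i \<in> X else xs ! i \<in> Y" .
  have "xs ! 0 \<in> X" using hd ne by (simp add: hd_conv_nth)
  then have "xs ! (length xs - 1) \<in> Y" using bip[OF cyc_nth(2)[OF xs]] XY by auto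
  then have "odd (length xs - 1)" using alt[of "length xs - 1"] ne XY by (auto split: if_splits)
  then show "even (length xs)" by (cases "length xs") auto
qed

lemma exch_bipartite:
  "exch M N S X Y u v \<Longrightarrow> u \<in> X \<and> v \<in> Y \<or> u \<in> Y \<and> v \<in> X"
  by (auto simp: exch_def)

text \<open>Write \<open>G a\<close> for the weight of the first \<open>2 * a + 1\<close> vertices. A chord from position \<open>2 * a\<close>
  to position \<open>2 * b + 1\<close> closes a shorter cycle, which is not negative; this gives
  \<open>G b \<le> G a\<close> if \<open>b < a\<close> and \<open>G b < G a\<close> if \<open>a < b\<close>. So chords decrease the pair
  \<open>(G a, a)\<close> lexicographically, and the key below encodes this pair.\<close>

lemma min_neg_cyc_chord_order:
  assumes xs: "min_neg_cyc E \<omega> xs" and m: "length xs = 2 * m"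
  obtains key :: "nat \<Rightarrow> int" where
    "\<And>a b. a < m \<Longrightarrow> b < m \<Longrightarrow> a \<noteq> b \<Longrightarrow> E (xs ! (2 * a)) (xs ! (2 * b + 1)) \<Longrightarrow> key b < key a"
proof
  define G where "G a = sum_list (map \<omega> (take (2 * a + 1) xs))" for a
  fix a b assume ab: "a < m" "b < m" "a \<noteq> b" and E: "E (xs ! (2 * a)) (xs ! (2 * b + 1))"
  show "G b * int m + int b < G a * int m + int a"
  proof (cases "b < a")
    case True
    then have "G b \<le> G a"
      unfolding G_def using min_neg_cyc_backward_chord[OF xs _ _ _ E] ab m by simp
    then have "G b * int m \<le> G a * int m" by (simp add: mult_right_mono)
    then show ?thesis using True by simp
  next
    case False
    then have "G b \<le> G a + sum_list (map \<omega> xs)"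
      unfolding G_def using min_neg_cyc_forward_chord[OF xs _ _ E] ab m by simp
    moreover have "sum_list (map \<omega> xs) < 0" using xs by (simp add: min_neg_cyc_def)
    ultimately have "(G b + 1) * int m \<le> G a * int m" by (intro mult_right_mono) auto
    then show ?thesis using ab by (simp add: algebra_simps)
  qed
qed

section \<open>Exchange along a minimal negative cycle\<close>

lemma set_split_parity:
  assumes "length xs = 2 * m"
  shows "set xs = (\<lambda>a. xs ! (2 * a)) ` {..<m} \<union> (\<lambda>a. xs ! (2 * a + 1)) ` {..<m}"
proof (intro equalityI subsetI)
  fix x assume "x \<in> set xs"
  then obtain i where i: "i < 2 * m" "x = xs ! i" using assms by (auto simp: in_set_conv_nth)
  show "x \<in> (\<lambda>a. xs ! (2 * a)) ` {..<m} \<union> (\<lambda>a. xs ! (2 * a + 1)) ` {..<m}"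
  proof (cases "even i")
    case True
    then show ?thesis using i by (intro UnI1 image_eqI[of _ _ "i div 2"]) auto
  next
    case False
    then show ?thesis using i by (intro UnI2 image_eqI[of _ _ "i div 2"]) auto
  qed
qed (use assms in auto)

lemma inj_on_nth_affine:
  assumes "distinct xs" "length xs = 2 * m"
  shows "inj_on (\<lambda>a. xs ! (2 * a)) {..<m}" "inj_on (\<lambda>a. xs ! (2 * a + 1)) {..<m}"
  using assms by (auto simp: inj_on_def nth_eq_iff_index_eq)

text \<open>Each even position of the cycle holds an element leaving \<open>S\<close>, the next
  position an element entering it, and the arc between them is a swap in \<open>M\<close>. The chord
  order supplies the triangular condition, so all these swaps can be made at once.\<close>

lemma (in bounded_matroid) exch_min_neg_cyc_leaving:
  assumes xs: "min_neg_cyc (exch M N S X Y) \<omega> xs" and hd: "hd xs \<in> X"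
    and S: "S \<in> M" "card S = k" and XY: "X \<subseteq> S" "Y \<inter> S = {}"
  shows "S - set xs \<union> (set xs - S) \<in> M"
proof -
  have c: "cyc (exch M N S X Y) xs" "distinct xs" using xs by (auto simp: min_neg_cyc_def cyc_def)
  have dis: "X \<inter> Y = {}" using XY by auto
  obtain m where m: "length xs = 2 * m" using bipartite_cyc_alternates(1)[OF c(1) dis hd exch_bipartite[of M N S X Y]] by blast
  let ?e = "\<lambda>a. xs ! (2 * a)" and ?f = "\<lambda>a. xs ! (2 * a + 1)"
  have e: "?e a \<in> X" if "a < m" for a
    using bipartite_cyc_alternates(2)[OF c(1) dis hd exch_bipartite[of M N S X Y], of "2 * a"] that m by simp
  have f: "?f a \<in> Y" if "a < m" for a
    using bipartite_cyc_alternates(2)[OF c(1) dis hd exch_bipartite[of M N S X Y], of "2 * a + 1"] that m by simp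
  obtain key :: "nat \<Rightarrow> int" where
    key: "\<And>a b. a < m \<Longrightarrow> b < m \<Longrightarrow> a \<noteq> b \<Longrightarrow> exch M N S X Y (?e a) (?f b) \<Longrightarrow> key b < key a"
    using min_neg_cyc_chord_order[OF xs m] by blast
  have "S - ?e ` {..<m} \<union> ?f ` {..<m} \<in> M"
  proof (rule triangular_exchange[OF S, of _ _ _ key])
    fix i assume "i \<in> {..<m}"
    then show "insert (?f i) (S - {?e i}) \<in> M"
      using cyc_nth(1)[OF c(1), of "2 * i"] m e[of i] dis by (auto simp: exch_def)
  next
    fix i j assume "i \<in> {..<m}" "j \<in> {..<m}" "i \<noteq> j" "insert (?f j) (S - {?e i}) \<in> M"
    then show "key j < key i" using key[of i j] e f by (auto simp: exch_def)
  qed (use inj_on_nth_affine[OF c(2) m] e f XY in auto)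
  moreover have "?e ` {..<m} \<subseteq> S" "?f ` {..<m} \<inter> S = {}" using e f XY by auto
  then have "S - ?e ` {..<m} \<union> ?f ` {..<m} = S - set xs \<union> (set xs - S)"
    unfolding set_split_parity[OF m] by blast
  ultimately show ?thesis by simp
qed

text \<open>Here \<open>M\<close> is the second matroid of the exchange graph, so its arcs run from
  entering to leaving elements. This reverses the chords, hence the negated key.\<close>

lemma (in bounded_matroid) exch_min_neg_cyc_entering:
  assumes xs: "min_neg_cyc (exch N M S X Y) \<omega> xs" and hd: "hd xs \<in> Y"
    and S: "S \<in> M" "card S = k" and XY: "X \<subseteq> S" "Y \<inter> S = {}"
  shows "S - set xs \<union> (set xs - S) \<in> M"
proof -
  have c: "cyc (exch N M S X Y) xs" "distinct xs" using xs by (auto simp: min_neg_cyc_def cyc_def)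
  have dis: "Y \<inter> X = {}" using XY by auto
  have bip: "u \<in> Y \<and> v \<in> X \<or> u \<in> X \<and> v \<in> Y" if "exch N M S X Y u v" for u v
    using exch_bipartite[OF that] by blast
  obtain m where m: "length xs = 2 * m"
    using bipartite_cyc_alternates(1)[OF c(1) dis hd bip] by blast
  let ?f = "\<lambda>a. xs ! (2 * a)" and ?e = "\<lambda>a. xs ! (2 * a + 1)"
  have f: "?f a \<in> Y" if "a < m" for a
    using bipartite_cyc_alternates(2)[OF c(1) dis hd bip, of "2 * a"] that m by simp
  have e: "?e a \<in> X" if "a < m" for a
    using bipartite_cyc_alternates(2)[OF c(1) dis hd bip, of "2 * a + 1"] that m by simp
  obtain key :: "nat \<Rightarrow> int" where
    key: "\<And>a b. a < m \<Longrightarrow> b < m \<Longrightarrow> a \<noteq> b \<Longrightarrow> exch N M S X Y (?f a) (?e b) \<Longrightarrow> key b < key a"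
    using min_neg_cyc_chord_order[OF xs m] by blast
  have "S - ?e ` {..<m} \<union> ?f ` {..<m} \<in> M"
  proof (rule triangular_exchange[OF S, of _ _ _ "\<lambda>a. - key a"])
    fix i assume "i \<in> {..<m}"
    then show "insert (?f i) (S - {?e i}) \<in> M"
      using cyc_nth(1)[OF c(1), of "2 * i"] m f[of i] dis by (auto simp: exch_def)
  next
    fix i j assume "i \<in> {..<m}" "j \<in> {..<m}" "i \<noteq> j" "insert (?f j) (S - {?e i}) \<in> M"
    then show "- key j < - key i" using key[of j i] e f by (auto simp: exch_def)
  qed (use inj_on_nth_affine[OF c(2) m] e f XY in auto)
  moreover have "?e ` {..<m} \<subseteq> S" "?f ` {..<m} \<inter> S = {}" using e f XY by auto
  then have "S - ?e ` {..<m} \<union> ?f ` {..<m} = S - set xs \<union> (set xs - S)"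
    unfolding set_split_parity[OF m] by blast
  ultimately show ?thesis by simp
qed

text \<open>The cycle carries two perfect matchings: each leaving element is paired with its
  successor for \<open>M\<close> and with its predecessor for \<open>N\<close>. Rotating the list by
  one place passes from one pairing to the other and keeps the vertex set.\<close>

lemma exch_min_neg_cyc:
  assumes M: "bounded_matroid V M k" and N: "bounded_matroid V N k"
    and S: "S \<in> M" "S \<in> N" "card S = k" and XY: "X \<subseteq> S" "Y \<inter> S = {}"
    and xs: "min_neg_cyc (exch M N S X Y) \<omega> xs"
  shows "S - set xs \<union> (set xs - S) \<in> M" "S - set xs \<union> (set xs - S) \<in> N"
proof -
  have c: "cyc (exch M N S X Y) xs" using xs by (auto simp: min_neg_cyc_def)
  have ne: "xs \<noteq> []" using c by (simp add: cyc_def)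
  note rot = min_neg_cyc_rotate1[OF xs]
  have hd_rot: "exch M N S X Y (hd xs) (hd (rotate1 xs))"
    using c by (cases xs) (auto simp: cyc_def successively_Cons hd_append split: if_splits)
  have "S - set xs \<union> (set xs - S) \<in> M \<and> S - set xs \<union> (set xs - S) \<in> N"
  proof (cases "hd xs \<in> X")
    case True
    then have "hd (rotate1 xs) \<in> Y" using exch_bipartite[OF hd_rot] XY by auto
    then show ?thesis
      using bounded_matroid.exch_min_neg_cyc_leaving[OF M xs True S(1,3) XY]
        bounded_matroid.exch_min_neg_cyc_entering[OF N rot _ S(2,3) XY] by simp
  next
    case False
    then have "hd xs \<in> Y" "hd (rotate1 xs) \<in> X" using exch_bipartite[OF hd_rot] by auto
    then show ?thesis
      using bounded_matroid.exch_min_neg_cyc_entering[OF N xs _ S(2,3) XY]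
        bounded_matroid.exch_min_neg_cyc_leaving[OF M rot _ S(1,3) XY] by simp
  qed
  then show "S - set xs \<union> (set xs - S) \<in> M" "S - set xs \<union> (set xs - S) \<in> N" by auto
qed

section \<open>Size and weight after an exchange\<close>

lemma bipartite_cyc_balanced:
  assumes xs: "cyc E xs" and XY: "X \<inter> Y = {}"
    and bip: "\<And>u v. E u v \<Longrightarrow> u \<in> X \<and> v \<in> Y \<or> u \<in> Y \<and> v \<in> X"
  shows "set xs \<subseteq> X \<union> Y" "card (set xs \<inter> X) = card (set xs \<inter> Y)"
proof -
  have main: "set xs \<subseteq> X' \<union> Y' \<and> card (set xs \<inter> X') = card (set xs \<inter> Y')"
    if XY: "X' \<inter> Y' = {}" and hd: "hd xs \<in> X'"
      and bip: "\<And>u v. E u v \<Longrightarrow> u \<in> X' \<and> v \<in> Y' \<or> u \<in> Y' \<and> v \<in> X'" for X' Y'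
  proof -
    note alt = bipartite_cyc_alternates[OF xs XY hd bip]
    obtain m where m: "length xs = 2 * m" using alt(1) by blast
    let ?e = "(\<lambda>a. xs ! (2 * a)) ` {..<m}" and ?f = "(\<lambda>a. xs ! (2 * a + 1)) ` {..<m}"
    have X: "?e \<subseteq> X'" and Y: "?f \<subseteq> Y'"
      using alt(2)[of "2 * a" for a] alt(2)[of "2 * a + 1" for a] m by fastforce+
    have "distinct xs" using xs by (simp add: cyc_def)
    then have "card ?e = card ?f" using inj_on_nth_affine[of xs m] m by (simp add: card_image)
    moreover have "set xs \<inter> X' = ?e" "set xs \<inter> Y' = ?f"
      using X Y XY unfolding set_split_parity[OF m] by blast+
    ultimately show ?thesis using X Y unfolding set_split_parity[OF m] by auto
  qed
  have "hd xs \<in> X \<or> hd xs \<in> Y" using bip[of "last xs" "hd xs"] xs by (auto simp: cyc_def)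
  then have "set xs \<subseteq> X \<union> Y \<and> card (set xs \<inter> X) = card (set xs \<inter> Y)"
  proof
    assume "hd xs \<in> X"
    then show ?thesis using main[OF XY] bip by blast
  next
    assume "hd xs \<in> Y"
    then have "set xs \<subseteq> Y \<union> X \<and> card (set xs \<inter> Y) = card (set xs \<inter> X)"
      using main[of Y X] XY bip by blast
    then show ?thesis by auto
  qed
  then show "set xs \<subseteq> X \<union> Y" "card (set xs \<inter> X) = card (set xs \<inter> Y)" by auto
qed

lemma sum_exchanged:
  fixes w :: "'b \<Rightarrow> int"
  assumes "distinct xs" "finite S"
  shows "sum w (S - set xs \<union> (set xs - S)) = sum w S - sum_list (map (\<lambda>v. if v \<in> S then w v else - w v) xs)"
proof -
  have "sum_list (map (\<lambda>v. if v \<in> S then w v else - w v) xs) = (\<Sum>v\<in>set xs. if v \<in> S then w v else - w v)"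
    using assms by (simp add: sum_list_distinct_conv_sum_set)
  also have "\<dots> = sum w (set xs \<inter> S) - sum w (set xs - S)"
    by (simp add: sum.If_cases sum_negf Diff_eq Collect_neg_eq)
  finally have 1: "sum_list (map (\<lambda>v. if v \<in> S then w v else - w v) xs) = sum w (set xs \<inter> S) - sum w (set xs - S)" .
  have "sum w S = sum w (S - set xs) + sum w (set xs \<inter> S)"
    using assms sum.Int_Diff[of S w "set xs"] by (simp add: Int_commute)
  moreover have "sum w (S - set xs \<union> (set xs - S)) = sum w (S - set xs) + sum w (set xs - S)"
    using assms by (intro sum.union_disjoint) auto
  ultimately show ?thesis using 1 by simp
qed

lemma card_exchanged:
  assumes xs: "cyc (exch M N S X Y) xs" and S: "finite S" and XY: "X \<subseteq> S" "Y \<inter> S = {}"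
  shows "card (S - set xs \<union> (set xs - S)) = card S"
proof -
  have "X \<inter> Y = {}" using XY by auto
  note b = bipartite_cyc_balanced[OF xs this exch_bipartite[of M N S X Y]]
  have "set xs \<inter> S = set xs \<inter> X" "set xs - S = set xs \<inter> Y" using b(1) XY by blast+
  then have "card (S \<inter> set xs) = card (set xs - S)" using b(2) by (simp add: Int_commute)
  moreover have "card (S - set xs \<union> (set xs - S)) = card (S - set xs) + card (set xs - S)"
    using S by (intro card_Un_disjoint) auto
  moreover have "card S = card (S \<inter> set xs) + card (S - set xs)"
    using S card_Int_Diff by blast
  ultimately show ?thesis by simp
qed

section \<open>Locally optimal bases and the base polytope\<close>

text \<open>Summation by parts: \<open>w\<close> is its minimum plus the sum of the indicators of
  its upper level sets, over the integers \<open>t\<close> above the minimum. The minimum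
  contributes nothing because \<open>h\<close> sums to zero.\<close>

lemma sum_weighted_levels_nonneg:
  fixes w h :: "'b \<Rightarrow> int"
  assumes V: "finite V" and total: "sum h V = 0"
    and levels: "\<And>t. 0 \<le> sum h {v\<in>V. t \<le> w v}"
  shows "0 \<le> (\<Sum>v\<in>V. w v * h v)"
proof (cases "V = {}")
  case False
  define a where "a = Min (w ` V)"
  define b where "b = Max (w ` V)"
  have ab: "a \<le> w v" "w v \<le> b" if "v \<in> V" for v using that V by (auto simp: a_def b_def)
  have w: "w v = a + (\<Sum>t\<in>{a<..b}. if t \<le> w v then 1 else 0)" if "v \<in> V" for v
  proof -
    have "{t. a < t \<and> t \<le> b \<and> t \<le> w v} = {a<..w v}" using ab[OF that] by auto
    then have "(\<Sum>t\<in>{a<..b}. if t \<le> w v then 1 else 0) = (\<Sum>t\<in>{a<..w v}. (1::int))"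
      by (subst sum.inter_filter[symmetric]) (auto intro!: sum.cong)
    then show ?thesis using ab[OF that] by simp
  qed
  have "(\<Sum>v\<in>V. w v * h v) = (\<Sum>v\<in>V. a * h v + (\<Sum>t\<in>{a<..b}. if t \<le> w v then h v else 0))"
    by (rule sum.cong, simp, subst w) (auto simp: ring_distribs sum_distrib_right intro!: sum.cong)
  also have "\<dots> = a * sum h V + (\<Sum>t\<in>{a<..b}. \<Sum>v\<in>V. if t \<le> w v then h v else 0)"
    by (simp add: sum.distrib sum_distrib_left sum.swap[of _ V])
  also have "\<dots> = (\<Sum>t\<in>{a<..b}. sum h {v\<in>V. t \<le> w v})"
    using V by (simp add: total sum.inter_filter)
  finally show ?thesis using levels by (simp add: sum_nonneg)
qed simp

text \<open>\<open>rank\<close> and \<open>total\<close> say that \<open>y\<close> lies in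
  \<open>n\<close> times the base polytope. Since no independent subset of an upper level set of
  \<open>w\<close> is larger than its intersection with \<open>S\<close>, the difference
  \<open>h\<close> between \<open>n\<close> times the indicator of \<open>S\<close> and
  \<open>y\<close> has nonnegative sum on each of these sets and total zero.\<close>

lemma (in bounded_matroid) locally_optimal_weight:
  fixes w y :: "'b \<Rightarrow> int"
  assumes S: "S \<in> M" "card S = k"
    and opt: "\<And>e f. e \<in> S \<Longrightarrow> f \<in> V - S \<Longrightarrow> insert f (S - {e}) \<in> M \<Longrightarrow> w f \<le> w e"
    and rank: "\<And>L. L \<subseteq> V \<Longrightarrow> \<exists>X\<in>M. X \<subseteq> L \<and> sum y L \<le> int n * int (card X)"
    and total: "sum y V = int n * int k"
  shows "(\<Sum>v\<in>V. w v * y v) \<le> int n * sum w S"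
proof -
  define h where "h v = (if v \<in> S then int n else 0) - y v" for v
  have SV: "S \<subseteq> V" "finite S" using S subset_ground finite_indep by auto
  have h: "sum h L = int n * int (card (L \<inter> S)) - sum y L" if "L \<subseteq> V" for L
    using finite_subset[OF that finite_ground]
    by (simp add: h_def sum_subtractf sum.If_cases mult.commute)
  have "0 \<le> (\<Sum>v\<in>V. w v * h v)"
  proof (rule sum_weighted_levels_nonneg[OF finite_ground])
    show "sum h V = 0" using h[of V] total SV S(2) by (simp add: Int_absorb1)
  next
    fix t
    let ?L = "{v\<in>V. t \<le> w v}"
    obtain X where X: "X \<in> M" "X \<subseteq> ?L" "sum y ?L \<le> int n * int (card X)"
      using rank[of ?L] by auto
    have "card X \<le> card {v\<in>S. t \<le> w v}" using locally_optimal_spans_level[OF S opt X(1,2)] .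
    moreover have "{v\<in>S. t \<le> w v} = ?L \<inter> S" using SV by auto
    ultimately have "int n * int (card X) \<le> int n * int (card (?L \<inter> S))"
      by (intro mult_left_mono) auto
    then show "0 \<le> sum h ?L" using h[of ?L] X(3) by simp
  qed
  also have "\<dots> = (\<Sum>v\<in>V. (if v \<in> S then int n * w v else 0) - w v * y v)"
    by (rule sum.cong) (auto simp: h_def algebra_simps)
  also have "\<dots> = int n * sum w S - (\<Sum>v\<in>V. w v * y v)"
    using SV finite_ground by (simp add: sum_subtractf sum.If_cases Int_absorb1 sum_distrib_left)
  finally show ?thesis by simp
qed

text \<open>Potentials of the exchange graph of a common basis of maximum weight split the weight into two
  parts, for which this basis is optimal in the first and in the second matroid, respectively.\<close>

lemma max_weight_common_basis:
  fixes w y :: "'b \<Rightarrow> int"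
  assumes M: "bounded_matroid V M k" and N: "bounded_matroid V N k"
    and S: "S \<in> M" "S \<in> N" "card S = k"
    and max: "\<And>T. T \<in> M \<Longrightarrow> T \<in> N \<Longrightarrow> card T = k \<Longrightarrow> sum w T \<le> sum w S"
    and rankM: "\<And>L. L \<subseteq> V \<Longrightarrow> \<exists>X\<in>M. X \<subseteq> L \<and> sum y L \<le> int n * int (card X)"
    and rankN: "\<And>L. L \<subseteq> V \<Longrightarrow> \<exists>X\<in>N. X \<subseteq> L \<and> sum y L \<le> int n * int (card X)"
    and total: "sum y V = int n * int k"
  shows "(\<Sum>v\<in>V. w v * y v) \<le> int n * sum w S"
proof -
  interpret M: bounded_matroid V M k by (rule M)
  interpret N: bounded_matroid V N k by (rule N)
  define \<omega> where "\<omega> v = (if v \<in> S then w v else - w v)" for v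
  let ?E = "exch M N S S (V - S)"
  have SV: "S \<subseteq> V" "finite S" using S M.subset_ground M.finite_indep by auto
  \<comment> \<open>Exchanging along a minimal negative cycle would turn \<open>S\<close> into a
    common basis of larger weight.\<close>
  have "0 \<le> sum_list (map \<omega> xs)" if "cyc ?E xs" for xs
  proof (rule ccontr)
    assume "\<not> ?thesis"
    then obtain ys where ys: "min_neg_cyc ?E \<omega> ys" using min_neg_cyc_exists[OF \<open>cyc ?E xs\<close>] by fastforce
    let ?T = "S - set ys \<union> (set ys - S)"
    have c: "cyc ?E ys" "distinct ys" "sum_list (map \<omega> ys) < 0"
      using ys by (auto simp: min_neg_cyc_def cyc_def)
    have "?T \<in> M" "?T \<in> N" using exch_min_neg_cyc[OF M N S _ _ ys] by auto
    moreover have "card ?T = k" using card_exchanged[OF c(1) SV(2)] S(3) by auto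
    ultimately have "sum w ?T \<le> sum w S" by (rule max)
    then show False using sum_exchanged[OF c(2) SV(2), of w] c(3) unfolding \<omega>_def by simp
  qed
  moreover have "u \<in> V \<and> v \<in> V" if "?E u v" for u v using that SV by (auto simp: exch_def)
  ultimately obtain p :: "'b \<Rightarrow> int" where p: "\<And>u v. ?E u v \<Longrightarrow> p v \<le> p u + \<omega> v"
    using potential_exists[OF M.finite_ground, of ?E \<omega>] by blast
  \<comment> \<open>An arc from \<open>e\<close> to \<open>f\<close> turns the potential inequality
    into \<open>w1 f \<le> w1 e\<close>. An arc from \<open>f\<close> to \<open>e\<close> turns it
    into \<open>w2 f \<le> w2 e\<close>, as \<open>w2\<close> is \<open>w - p\<close> on
    \<open>S\<close> and \<open>- p\<close> off \<open>S\<close>.\<close>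
  define w1 where "w1 v = (if v \<in> S then p v else p v + w v)" for v
  define w2 where "w2 v = w v - w1 v" for v
  have "(\<Sum>v\<in>V. w1 v * y v) \<le> int n * sum w1 S"
  proof (rule M.locally_optimal_weight[OF S(1,3) _ rankM total])
    fix e f assume "e \<in> S" "f \<in> V - S" "insert f (S - {e}) \<in> M"
    then show "w1 f \<le> w1 e" using p[of e f] by (auto simp: exch_def w1_def \<omega>_def)
  qed
  moreover have "(\<Sum>v\<in>V. w2 v * y v) \<le> int n * sum w2 S"
  proof (rule N.locally_optimal_weight[OF S(2,3) _ rankN total])
    fix e f assume "e \<in> S" "f \<in> V - S" "insert f (S - {e}) \<in> N"
    then show "w2 f \<le> w2 e" using p[of f e] by (auto simp: exch_def w2_def w1_def \<omega>_def)
  qed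
  moreover have "w v = w1 v + w2 v" for v by (simp add: w2_def)
  ultimately show ?thesis by (simp add: sum.distrib distrib_left distrib_right)
qed

section \<open>Common bases that are heavy on a given set\<close>

lemma bounded_matroid_truncate:
  assumes "bounded_matroid V M r"
  shows "bounded_matroid V {X\<in>M. card X \<le> k} k"
proof -
  interpret bounded_matroid V M r by (rule assms)
  show ?thesis
  proof
    fix X Y assume XY: "X \<in> {X\<in>M. card X \<le> k}" "Y \<in> {X\<in>M. card X \<le> k}" "card X < card Y"
    then obtain y where y: "y \<in> Y - X" "insert y X \<in> M" using exchange by blast
    then have "card (insert y X) = Suc (card X)" using finite_indep[of X] XY by simp
    then show "\<exists>y\<in>Y - X. insert y X \<in> {X\<in>M. card X \<le> k}"
      using y XY by (intro bexI[of _ y]) auto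
  next
    fix X Y assume "X \<in> {X\<in>M. card X \<le> k}" "Y \<subseteq> X"
    then show "Y \<in> {X\<in>M. card X \<le> k}"
      using indep_subset[of X Y] card_mono[OF finite_indep, of X Y] by auto
  qed (use finite_ground subset_ground empty_indep in auto)
qed

text \<open>The direct sum of \<open>M\<close> with the free matroid on \<open>k\<close> new
  elements, truncated to size \<open>k\<close>.\<close>

definition with_dummies :: "nat \<Rightarrow> 'a set set \<Rightarrow> ('a + nat) set set" where
  "with_dummies k M = {I <+> D |I D. I \<in> M \<and> D \<subseteq> {..<k} \<and> card I + card D \<le> k}"

lemma Plus_vimage: "(Inl -` Y) <+> (Inr -` Y) = Y"
proof (rule set_eqI)
  show "x \<in> (Inl -` Y) <+> (Inr -` Y) \<longleftrightarrow> x \<in> Y" for x by (cases x) auto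
qed

lemma with_dummiesI:
  "I \<in> M \<Longrightarrow> D \<subseteq> {..<k} \<Longrightarrow> card I + card D \<le> k \<Longrightarrow> I <+> D \<in> with_dummies k M"
  by (auto simp: with_dummies_def)

lemma bounded_matroid_with_dummies:
  assumes "bounded_matroid V M r"
  shows "bounded_matroid (V <+> {..<k}) (with_dummies k M) k"
proof -
  interpret bounded_matroid V M r by (rule assms)
  have fin: "finite D" if "D \<subseteq> {..<k}" for D :: "nat set" using that finite_subset by blast
  show ?thesis
  proof
    show "finite (V <+> {..<k})" using finite_ground by simp
    show "X \<in> with_dummies k M \<Longrightarrow> X \<subseteq> V <+> {..<k}" for X
      using subset_ground by (fastforce simp: with_dummies_def)
    show "{} \<in> with_dummies k M"
      using empty_indep by (auto simp: with_dummies_def intro!: exI[of _ "{}"])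
    show "X \<in> with_dummies k M \<Longrightarrow> card X \<le> k" for X
      using finite_indep fin by (auto simp: with_dummies_def card_Plus)
  next
    fix X Y assume "X \<in> with_dummies k M" and Y: "Y \<subseteq> X"
    then obtain I D where X: "X = I <+> D" "I \<in> M" "D \<subseteq> {..<k}" "card I + card D \<le> k"
      by (auto simp: with_dummies_def)
    have s: "Inl -` Y \<subseteq> I" "Inr -` Y \<subseteq> D" using Y X(1) by auto
    then have "card (Inl -` Y) \<le> card I" "card (Inr -` Y) \<le> card D"
      using X fin finite_indep by (auto intro: card_mono)
    then have "(Inl -` Y) <+> (Inr -` Y) \<in> with_dummies k M"
      using s X indep_subset[OF X(2) s(1)] by (intro with_dummiesI) auto
    then show "Y \<in> with_dummies k M" by (simp add: Plus_vimage)
  next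
    fix X Y assume "X \<in> with_dummies k M" "Y \<in> with_dummies k M" and less: "card X < card Y"
    then obtain I D J F where X: "X = I <+> D" "I \<in> M" "D \<subseteq> {..<k}" "card I + card D \<le> k"
      and Y: "Y = J <+> F" "J \<in> M" "F \<subseteq> {..<k}" "card J + card F \<le> k"
      by (auto simp: with_dummies_def)
    have f: "finite I" "finite D" "finite J" "finite F" using X Y fin finite_indep by auto
    then have less': "card I + card D < card J + card F" using less X(1) Y(1) by (simp add: card_Plus)
    show "\<exists>y\<in>Y - X. insert y X \<in> with_dummies k M"
    proof (cases "card I < card J")
      case True
      then obtain v where v: "v \<in> J - I" "insert v I \<in> M" using exchange X Y by blast
      have "insert (Inl v) X = insert v I <+> D" using X by auto
      moreover have "card (insert v I) + card D \<le> k" using v f less' Y by simp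
      ultimately have "insert (Inl v) X \<in> with_dummies k M"
        using with_dummiesI[OF v(2) X(3)] by simp
      then show ?thesis using v X Y by (intro bexI[of _ "Inl v"]) auto
    next
      case False
      then have "card D < card F" using less' by simp
      then obtain i where i: "i \<in> F - D" using f by (metis DiffI card_mono leD subsetI)
      have "insert (Inr i) X = I <+> insert i D" using X by auto
      moreover have "card I + card (insert i D) \<le> k" using i f less' Y by simp
      moreover have "insert i D \<subseteq> {..<k}" using i Y X by auto
      ultimately have "insert (Inr i) X \<in> with_dummies k M"
        using with_dummiesI[OF X(2)] by simp
      then show ?thesis using i X Y by (intro bexI[of _ "Inr i"]) auto
    qed
  qed
qed

text \<open>The \<open>k\<close> dummies make common bases of size \<open>k\<close> exist; the weight prefers ground elements
  to dummies and then elements of \<open>A\<close> to others, and is tested against the constant vector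
  \<open>k / n\<close> on the ground set.\<close>

lemma common_basis_heavy_on:
  assumes P: "bounded_matroid V P r" and Q: "bounded_matroid V Q r"
    and n: "n = card V" "0 < n" and A: "A \<subseteq> V"
    and rankP: "\<And>L. L \<subseteq> V \<Longrightarrow> \<exists>X\<in>P. X \<subseteq> L \<and> card L * k \<le> n * card X"
    and rankQ: "\<And>L. L \<subseteq> V \<Longrightarrow> \<exists>X\<in>Q. X \<subseteq> L \<and> card L * k \<le> n * card X"
  shows "\<exists>S\<in>P \<inter> Q. card S = k \<and> k * card A \<le> n * card (S \<inter> A)"
proof -
  interpret P: bounded_matroid V P r by (rule P)
  let ?V = "V <+> {..<k}" and ?P = "with_dummies k P" and ?Q = "with_dummies k Q"
  note P' = bounded_matroid_with_dummies[OF P, of k] and Q' = bounded_matroid_with_dummies[OF Q, of k]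
  define w :: "'a + nat \<Rightarrow> int" where
    "w = case_sum (\<lambda>v. int n + 1 + (if v \<in> A then 1 else 0)) (\<lambda>_. 0)"
  define y :: "'a + nat \<Rightarrow> int" where "y = case_sum (\<lambda>_. int k) (\<lambda>_. 0)"
  have fV: "finite V" by (rule P.finite_ground)
  let ?C = "{S. S \<in> ?P \<and> S \<in> ?Q \<and> card S = k}"
  have "{} <+> {..<k} \<in> ?C"
    using with_dummiesI[OF P.empty_indep, of "{..<k}" k]
      with_dummiesI[OF bounded_matroid.empty_indep[OF Q], of "{..<k}" k] by (simp add: card_Plus)
  moreover have fin: "finite ?C"
    using bounded_matroid.subset_ground[OF P'] bounded_matroid.finite_ground[OF P']
    by (intro finite_subset[of ?C "Pow ?V"]) auto
  ultimately have "Max (sum w ` ?C) \<in> sum w ` ?C" by (intro Max_in) auto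
  then obtain S where S: "S \<in> ?C" and "sum w S = Max (sum w ` ?C)" by auto
  then have max: "sum w T \<le> sum w S" if "T \<in> ?C" for T using that fin by auto
  have rank': "\<exists>X\<in>with_dummies k M. X \<subseteq> L \<and> sum y L \<le> int n * int (card X)"
    if L: "L \<subseteq> ?V" and M: "bounded_matroid V M r"
      and rank: "\<And>L. L \<subseteq> V \<Longrightarrow> \<exists>X\<in>M. X \<subseteq> L \<and> card L * k \<le> n * card X" for L M
  proof -
    have L': "Inl -` L \<subseteq> V" "Inr -` L \<subseteq> {..<k}" using L by auto
    then have fin: "finite (Inl -` L)" "finite (Inr -` L)" using fV by (auto intro: finite_subset)
    have "sum y L = sum y ((Inl -` L) <+> (Inr -` L))" by (simp only: Plus_vimage)
    also have "\<dots> = int (card (Inl -` L) * k)" using fin by (simp add: sum.Plus o_def y_def)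
    finally have y: "sum y L = int (card (Inl -` L) * k)" .
    obtain X where X: "X \<in> M" "X \<subseteq> Inl -` L" "card (Inl -` L) * k \<le> n * card X"
      using rank[OF L'(1)] by blast
    \<comment> \<open>\<open>X\<close> may be too large for the extended matroid. After cutting it
      down to at most \<open>k\<close> elements the bound still holds, because \<open>L\<close>
      contains at most \<open>n\<close> ground elements.\<close>
    obtain X0 where X0: "X0 \<subseteq> X" "card X0 = min (card X) k"
      using obtain_subset_with_card_n[of "min (card X) k" X] by auto
    have "card (Inl -` L) * k \<le> n * k" using L'(1) fV n card_mono by (intro mult_right_mono) auto
    then have "card (Inl -` L) * k \<le> n * card X0" using X(3) X0(2) by (simp add: min_def)
    moreover have "X0 <+> {} \<in> with_dummies k M"
      using bounded_matroid.indep_subset[OF M X(1) X0(1)] X0(2) by (intro with_dummiesI) auto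
    moreover have "X0 <+> {} \<subseteq> L" using X0 X by auto
    moreover have "card (X0 <+> ({}::nat set)) = card X0"
      using finite_subset[OF X0(1)] finite_subset[OF X(2) fin(1)] by (simp add: card_Plus)
    ultimately show ?thesis using y by (metis of_nat_le_iff of_nat_mult)
  qed
  have opt: "(\<Sum>v\<in>?V. w v * y v) \<le> int n * sum w S"
  proof (rule max_weight_common_basis[OF P' Q'])
    show "sum y ?V = int n * int k" using fV n by (simp add: sum.Plus o_def y_def)
  qed (use S max rank' P Q rankP rankQ in auto)
  have avg: "(\<Sum>v\<in>?V. w v * y v) = int (n * (n + 1) * k + k * card A)"
    using fV n A
    by (simp add: sum.Plus o_def w_def y_def sum.distrib sum.If_cases Int_absorb1 algebra_simps flip: sum_distrib_left)
  obtain I D where I: "S = I <+> D" "I \<in> P" "D \<subseteq> {..<k}" "card I + card D \<le> k"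
    using S by (auto simp: with_dummies_def)
  have fI: "finite I" "finite D" using I P.finite_indep by (auto intro: finite_subset)
  have "sum w S = int ((n + 1) * card I + card (I \<inter> A))"
    using fI by (simp add: I(1) sum.Plus o_def w_def sum.distrib sum.If_cases algebra_simps)
  then have "int (n * (n + 1) * k + k * card A) \<le> int (n * ((n + 1) * card I + card (I \<inter> A)))"
    using opt unfolding avg by (simp only: of_nat_mult)
  then have key: "n * (n + 1) * k + k * card A \<le> n * ((n + 1) * card I + card (I \<inter> A))"
    by (simp only: of_nat_le_iff)
  \<comment> \<open>If \<open>I\<close> had fewer than \<open>k\<close> elements, each missing one
    would cost \<open>n + 1\<close> in weight, and the bonuses for \<open>A\<close>, at most
    \<open>n\<close> in total, could not make up for it. So \<open>S\<close> contains no
    dummy.\<close>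
  have "card I = k"
  proof (rule ccontr)
    assume "card I \<noteq> k"
    then have "Suc (card I) \<le> k" using I by simp
    then have "n * (n + 1) * Suc (card I) \<le> n * (n + 1) * k" by (rule mult_left_mono) simp
    moreover have "card (I \<inter> A) \<le> n"
      unfolding n using P.subset_ground[OF I(2)] fV by (intro card_mono) auto
    then have "n * card (I \<inter> A) \<le> n * n" by (rule mult_le_mono2)
    moreover have "0 < n" by (rule n)
    ultimately show False
      using key by (simp only: algebra_simps mult_Suc_right mult_1_right)
  qed
  moreover have "I \<in> Q"
  proof -
    obtain J F where "S = J <+> F" "J \<in> Q" using S by (auto simp: with_dummies_def)
    moreover have "J = I" using calculation I(1) by (auto simp: set_eq_iff)
    ultimately show ?thesis by simp
  qed
  ultimately show ?thesis using key I(2) by (intro bexI[of _ I]) (auto simp: algebra_simps)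
qed

section \<open>From one common basis to another\<close>

text \<open>With constant weights every cycle is negative, so the shortest one has no chords.\<close>

lemma shortest_cyc_chordless:
  fixes xs :: "'b list"
  assumes xs: "min_neg_cyc E (\<lambda>_. - 1) xs" and ij: "i < length xs" "j < length xs"
    and E: "E (xs ! i) (xs ! j)"
  shows "j = Suc i \<or> j = 0 \<and> Suc i = length xs"
proof (rule ccontr)
  assume n: "\<not> ?thesis"
  have s: "sum_list (map (\<lambda>_. - 1) ys) = - int (length ys)" for ys :: "'b list"
    by (induction ys) auto
  show False
  proof (cases "j \<le> i")
    case True
    then have "Suc i - j < length xs" using n ij by arith
    then show False using min_neg_cyc_backward_chord[OF xs True ij(1) _ E] ij n True by (simp add: s)
  next
    case False
    then show False using min_neg_cyc_forward_chord[OF xs _ ij(2) E] ij n by (simp add: s)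
  qed
qed

text \<open>Without cycles the constant weight -1 admits a potential, which strictly decreases along
  every arc. A vertex of \<open>U\<close> where it is least would have no outgoing arc.\<close>

lemma cyc_exists_if_no_sink:
  fixes U :: "'b set"
  assumes U: "finite U" "U \<noteq> {}" and E: "\<And>u v. E u v \<Longrightarrow> u \<in> U \<and> v \<in> U"
    and out: "\<And>u. u \<in> U \<Longrightarrow> \<exists>v. E u v"
  shows "\<exists>xs. min_neg_cyc E (\<lambda>_. - 1) xs"
proof (rule ccontr)
  assume none: "\<not> ?thesis"
  have "0 \<le> sum_list (map (\<lambda>_. - 1 :: int) xs)" if "cyc E xs" for xs
    using min_neg_cyc_exists[OF that, of "\<lambda>_. - 1"] none by fastforce
  then obtain p :: "'b \<Rightarrow> int" where p: "\<And>u v. E u v \<Longrightarrow> p v \<le> p u + - 1"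
    using potential_exists[OF U(1) E, where \<omega> = "\<lambda>_. - 1"] by blast
  have "Min (p ` U) \<in> p ` U" using U by simp
  then obtain u where u: "u \<in> U" "p u = Min (p ` U)" by auto
  then obtain v where "E u v" using out by blast
  then have "v \<in> U" "p v < p u" using E p by fastforce+
  moreover have "p u \<le> p v" using u(2) U(1) \<open>v \<in> U\<close> by simp
  ultimately show False by simp
qed

text \<open>No vertex is a sink. For \<open>u\<close> in \<open>S - T\<close>, augment
  \<open>S - {u}\<close> from \<open>T\<close> in \<open>M\<close>. For \<open>u\<close> in
  \<open>T - S\<close>, the set \<open>insert u (S \<inter> T)\<close> is independent in
  \<open>N\<close>, so \<open>swap\<close> can keep \<open>S \<inter> T\<close> and remove an
  element of \<open>S - T\<close>.\<close>

lemma shortest_exch_cyc_exists: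
  assumes M: "bounded_matroid V M k" and N: "bounded_matroid V N k"
    and S: "S \<in> M" "S \<in> N" "card S = k" and T: "T \<in> M" "T \<in> N" "card T = k" and ne: "S \<noteq> T"
  shows "\<exists>xs. min_neg_cyc (exch M N S (S - T) (T - S)) (\<lambda>_. - 1) xs"
proof (rule cyc_exists_if_no_sink)
  interpret M: bounded_matroid V M k by (rule M)
  interpret N: bounded_matroid V N k by (rule N)
  let ?U = "(S - T) \<union> (T - S)"
  show "finite ?U" using S T M.finite_indep by auto
  show "?U \<noteq> {}" using ne by auto
  show "u \<in> ?U \<and> v \<in> ?U" if "exch M N S (S - T) (T - S) u v" for u v
    using exch_bipartite[OF that] by auto
  fix u assume "u \<in> ?U"
  then show "\<exists>v. exch M N S (S - T) (T - S) u v"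
  proof
    assume u: "u \<in> S - T"
    have "S - {u} \<in> M" using S M.indep_subset by blast
    moreover have "card (S - {u}) < card T"
      using u S T M.finite_indep by (metis DiffD1 card_Diff1_less)
    ultimately obtain v where "v \<in> T - (S - {u})" "insert v (S - {u}) \<in> M"
      using M.exchange T by blast
    then show ?thesis using u by (auto simp: exch_def)
  next
    assume u: "u \<in> T - S"
    have "insert u (S \<inter> T) \<subseteq> T" using u by auto
    then have "insert u (S \<inter> T) \<in> N" using T N.indep_subset by blast
    then obtain e where "e \<in> S - S \<inter> T" "insert u (S - {e}) \<in> N"
      using N.swap[OF S(2,3), of "S \<inter> T" u] u by auto
    then show ?thesis using u by (auto simp: exch_def)
  qed
qed

text \<open>Truncating the shortest cycle \<open>e 0, f 0, e 1, f 1, \<dots>\<close> after \<open>f (j - 1)\<close> and additionally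
  dropping \<open>e j\<close> keeps independence in both matroids: the pairs \<open>(e i, f i)\<close> are exchanged in the
  first and the pairs \<open>(e (i + 1), f i)\<close> in the second.\<close>

lemma partial_exchange_common:
  assumes M: "bounded_matroid V M k" and N: "bounded_matroid V N k"
    and S: "S \<in> M" "S \<in> N" "card S = k" and XY: "X \<subseteq> S" "Y \<inter> S = {}"
    and xs: "min_neg_cyc (exch M N S X Y) (\<lambda>_. - 1) xs"
    and e: "\<And>a. a < m \<Longrightarrow> xs ! (2 * a) \<in> X" and f: "\<And>a. a < m \<Longrightarrow> xs ! (2 * a + 1) \<in> Y"
    and m: "length xs = 2 * m" and j: "j < m"
  defines "R \<equiv> S - (\<lambda>a. xs ! (2 * a)) ` {..j} \<union> (\<lambda>a. xs ! (2 * a + 1)) ` {..<j}"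
  shows "R \<in> M" "R \<in> N"
proof -
  let ?e = "\<lambda>a. xs ! (2 * a)" and ?f = "\<lambda>a. xs ! (2 * a + 1)"
  have c: "cyc (exch M N S X Y) xs" "distinct xs" using xs by (auto simp: min_neg_cyc_def cyc_def)
  have dis: "X \<inter> Y = {}" using XY by auto
  note inj = inj_on_nth_affine[OF c(2) m]
  have eS: "?e a \<in> S" and fS: "?f a \<notin> S" if "a < m" for a
    using e[OF that] f[OF that] XY by auto
  have injf: "inj_on ?f {..<j}" using inj(2) j by (auto intro: inj_on_subset)
  have "S - ?e ` {..<j} \<union> ?f ` {..<j} \<in> M"
  \<comment> \<open>A shortest cycle has no chords, so only the diagonal pairs are exchangeable and
    a constant key serves.\<close>
  proof (rule bounded_matroid.triangular_exchange[OF M S(1,3), of _ _ _ "\<lambda>_. 0"])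
    show "inj_on ?e {..<j}" using inj(1) j by (auto intro: inj_on_subset)
    show "?e ` {..<j} \<subseteq> S" using eS j by auto
    show "?f ` {..<j} \<inter> S = {}" using fS j by auto
  next
    fix a assume "a \<in> {..<j}"
    then show "insert (?f a) (S - {?e a}) \<in> M"
      using cyc_nth(1)[OF c(1), of "2 * a"] m e[of a] j dis by (auto simp: exch_def)
  next
    fix a b assume ab: "a \<in> {..<j}" "b \<in> {..<j}" "a \<noteq> b" "insert (?f b) (S - {?e a}) \<in> M"
    then have "exch M N S X Y (?e a) (?f b)" using e[of a] f[of b] j by (auto simp: exch_def)
    then show "(0::int) < 0" using shortest_cyc_chordless[OF xs, of "2 * a" "2 * b + 1"] ab m j by auto
  qed (use injf in auto)
  then show "R \<in> M"
    by (rule bounded_matroid.indep_subset[OF M]) (auto simp: R_def)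
  have "S - (\<lambda>a. ?e (a + 1)) ` {..<j} \<union> ?f ` {..<j} \<in> N"
  proof (rule bounded_matroid.triangular_exchange[OF N S(2,3), of _ _ _ "\<lambda>_. 0"])
    show "inj_on (\<lambda>a. ?e (a + 1)) {..<j}"
    proof (rule inj_onI)
      fix a b assume "a \<in> {..<j}" "b \<in> {..<j}" "?e (a + 1) = ?e (b + 1)"
      then show "a = b" using inj_onD[OF inj(1), of "a + 1" "b + 1"] j by auto
    qed
    show "(\<lambda>a. ?e (a + 1)) ` {..<j} \<subseteq> S" using eS[of "Suc a" for a] j by auto
    show "?f ` {..<j} \<inter> S = {}" using fS j by auto
  next
    fix a assume "a \<in> {..<j}"
    then show "insert (?f a) (S - {?e (a + 1)}) \<in> N"
      using cyc_nth(1)[OF c(1), of "2 * a + 1"] m f[of a] j dis by (auto simp: exch_def)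
  next
    fix a b assume ab: "a \<in> {..<j}" "b \<in> {..<j}" "a \<noteq> b" "insert (?f b) (S - {?e (a + 1)}) \<in> N"
    then have "exch M N S X Y (?f b) (?e (a + 1))"
      using e[of "a + 1"] f[of b] j by (auto simp: exch_def)
    then show "(0::int) < 0"
      using shortest_cyc_chordless[OF xs, of "2 * b + 1" "2 * (a + 1)"] ab m j by auto
  qed (use injf in auto)
  moreover have "(\<lambda>a. ?e (a + 1)) ` {..<j} \<subseteq> ?e ` {..j}"
    by (intro image_subsetI) (rule image_eqI[of _ ?e "_ + 1"], auto)
  then have "R \<subseteq> S - (\<lambda>a. ?e (a + 1)) ` {..<j} \<union> ?f ` {..<j}" unfolding R_def by blast
  ultimately show "R \<in> N" by (rule bounded_matroid.indep_subset[OF N])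
qed

text \<open>The exchange passes through sets \<open>R j\<close> of size \<open>k - 1\<close>, from
  \<open>S\<close> without one element to the new basis without one element. Each step adds one
  element and removes one, so the size of the intersection with \<open>A\<close> changes by at most
  one and attains \<open>c - 1\<close>. The other \<open>k - c\<close> elements of that
  \<open>R j\<close> lie outside \<open>A\<close>.\<close>

lemma crossing_shortest_exch_cyc:
  assumes M: "bounded_matroid V M k" and N: "bounded_matroid V N k"
    and S: "S \<in> M" "S \<in> N" "card S = k" and XY: "X \<subseteq> S" "Y \<inter> S = {}"
    and xs: "min_neg_cyc (exch M N S X Y) (\<lambda>_. - 1) xs"
    and before: "c \<le> card (S \<inter> A)" and after: "card ((S - set xs \<union> (set xs - S)) \<inter> A) < c"
  shows "\<exists>I\<in>M \<inter> N. c \<le> card (I \<inter> A) + 1 \<and> k \<le> card (I - A) + c"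
proof -
  have dis: "X \<inter> Y = {}" using XY by auto
  have fS: "finite S" using bounded_matroid.finite_indep[OF M S(1)] .
  have "\<exists>xs. min_neg_cyc (exch M N S X Y) (\<lambda>_. - 1) xs \<and> hd xs \<in> X \<and>
      card ((S - set xs \<union> (set xs - S)) \<inter> A) < c"
  proof (cases "hd xs \<in> X")
    case False
    have "exch M N S X Y (hd xs) (hd (rotate1 xs))"
      using xs by (cases xs) (auto simp: min_neg_cyc_def cyc_def successively_Cons hd_append split: if_splits)
    then have "hd (rotate1 xs) \<in> X" using exch_bipartite False by fastforce
    then show ?thesis using min_neg_cyc_rotate1[OF xs] after by (intro exI[of _ "rotate1 xs"]) simp
  qed (use xs after in blast)
  then obtain xs where xs: "min_neg_cyc (exch M N S X Y) (\<lambda>_. - 1) xs" and hd: "hd xs \<in> X"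
    and after: "card ((S - set xs \<union> (set xs - S)) \<inter> A) < c" by blast
  have c: "cyc (exch M N S X Y) xs" "distinct xs" "xs \<noteq> []"
    using xs by (auto simp: min_neg_cyc_def cyc_def)
  note alt = bipartite_cyc_alternates[OF c(1) dis hd exch_bipartite[of M N S X Y]]
  obtain m where m: "length xs = 2 * m" using alt(1) by blast
  then have m0: "0 < m" using c(3) by (cases m) auto
  let ?e = "\<lambda>a. xs ! (2 * a)" and ?f = "\<lambda>a. xs ! (2 * a + 1)"
  have e: "?e a \<in> X" if "a < m" for a using alt(2)[of "2 * a"] that m by simp
  have f: "?f a \<in> Y" if "a < m" for a using alt(2)[of "2 * a + 1"] that m by simp
  have eS: "?e a \<in> S" and fS': "?f a \<notin> S" if "a < m" for a
    using e[OF that] f[OF that] XY by auto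
  note inj = inj_on_nth_affine[OF c(2) m]
  define R where "R j = S - ?e ` {..j} \<union> ?f ` {..<j}" for j
  have R: "R j \<in> M" "R j \<in> N" if "j < m" for j
    unfolding R_def using partial_exchange_common[OF M N S XY xs e f m that] by auto
  have cR: "card (R j) + 1 = k" if "j < m" for j
  proof -
    have "inj_on ?e {..j}" "inj_on ?f {..<j}" using inj that by (auto intro: inj_on_subset)
    then have "card (?e ` {..j}) = j + 1" "card (?f ` {..<j}) = j" by (simp_all add: card_image)
    moreover have sub: "?e ` {..j} \<subseteq> S" "?f ` {..<j} \<inter> S = {}" using eS fS' that by auto
    moreover have "card (R j) = card (S - ?e ` {..j}) + card (?f ` {..<j})"
      unfolding R_def using fS sub(2) by (intro card_Un_disjoint) auto
    moreover have "card (?e ` {..j}) \<le> card S" using fS sub(1) card_mono by blast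
    ultimately show ?thesis using S(3) by (simp add: card_Diff_subset)
  qed
  have fR: "finite (R j)" for j using fS by (simp add: R_def)
  define g where "g j = card (R j \<inter> A)" for j
  have step: "g j \<le> Suc (g (Suc j)) \<and> g (Suc j) \<le> Suc (g j)" for j
  proof
    have "R j \<inter> A \<subseteq> insert (?e (Suc j)) (R (Suc j) \<inter> A)"
      by (auto simp: R_def atMost_Suc lessThan_Suc)
    then have "g j \<le> card (insert (?e (Suc j)) (R (Suc j) \<inter> A))"
      unfolding g_def using fR by (intro card_mono) auto
    also have "\<dots> \<le> Suc (g (Suc j))" unfolding g_def using fR by (simp add: card_insert_if)
    finally show "g j \<le> Suc (g (Suc j))" .
    have "R (Suc j) \<inter> A \<subseteq> insert (?f j) (R j \<inter> A)"
      by (auto simp: R_def atMost_Suc lessThan_Suc)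
    then have "g (Suc j) \<le> card (insert (?f j) (R j \<inter> A))"
      unfolding g_def using fR by (intro card_mono) auto
    also have "\<dots> \<le> Suc (g j)" unfolding g_def using fR by (simp add: card_insert_if)
    finally show "g (Suc j) \<le> Suc (g j)" .
  qed
  have "S \<inter> A \<subseteq> insert (?e 0) (R 0 \<inter> A)" by (auto simp: R_def)
  then have "card (S \<inter> A) \<le> card (insert (?e 0) (R 0 \<inter> A))"
    using fR by (intro card_mono) auto
  also have "\<dots> \<le> Suc (g 0)" unfolding g_def using fR by (simp add: card_insert_if)
  finally have g0: "c \<le> Suc (g 0)" using before by simp
  have "R (m - 1) \<subseteq> S - set xs \<union> (set xs - S)"
  proof -
    have "{..m - 1} = {..<m}" using m0 by auto
    moreover have "?f ` {..<m} \<inter> S = {}" using fS' by auto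
    moreover have "?f ` {..<m - 1} \<subseteq> ?f ` {..<m}" by auto
    ultimately show ?thesis unfolding R_def set_split_parity[OF m] by blast
  qed
  then have "g (m - 1) \<le> card ((S - set xs \<union> (set xs - S)) \<inter> A)"
    unfolding g_def using fS by (intro card_mono) auto
  then have gm: "g (m - 1) < c" using after by simp
  \<comment> \<open>The target is \<open>c - 1\<close> because removing the first element may
    already bring the intersection from \<open>c\<close> down to \<open>c - 1\<close>. The signs
    turn the descent past the target into an ascent.\<close>
  obtain j where j: "j \<le> m - 1" "- int (g j) = - (int c - 1)"
  proof -
    have "\<bar>- int (g (i + 1)) - - int (g i)\<bar> \<le> 1" for i
      using step[of i] by (simp add: abs_le_iff)
    moreover have "- int (g 0) \<le> - (int c - 1)" "- (int c - 1) \<le> - int (g (m - 1))"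
      using g0 gm by auto
    ultimately show ?thesis
      using nat0_intermed_int_val[of "m - 1" "\<lambda>j. - int (g j)" "- (int c - 1)"] that by blast
  qed
  then have jm: "j < m" and gj: "g j + 1 = c" using m0 by auto
  have "card (R j) = card (R j \<inter> A) + card (R j - A)" using fR card_Int_Diff by blast
  then have "k \<le> card (R j - A) + c" using cR[OF jm] gj by (simp add: g_def)
  then show ?thesis using R[OF jm] gj by (intro bexI[of _ "R j"]) (auto simp: g_def)
qed

text \<open>Each shortest cycle in the symmetric difference makes \<open>S - T\<close> smaller. If
  the intersection with \<open>A\<close> still has at least \<open>c\<close> elements afterwards,
  induction applies; otherwise the cycle crosses \<open>c\<close> and
  \<open>crossing_shortest_exch_cyc\<close> yields \<open>I\<close>. If \<open>T\<close> meets
  \<open>A\<close> in exactly \<open>c\<close> elements, \<open>T\<close> itself serves.\<close>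

lemma balanced_common_independent:
  assumes M: "bounded_matroid V M k" and N: "bounded_matroid V N k"
    and S: "S \<in> M" "S \<in> N" "card S = k" "c \<le> card (S \<inter> A)"
    and T: "T \<in> M" "T \<in> N" "card T = k" "card (T \<inter> A) \<le> c"
  shows "\<exists>I\<in>M \<inter> N. c \<le> card (I \<inter> A) + 1 \<and> k \<le> card (I - A) + c"
  using S
proof (induction "card (S - T)" arbitrary: S rule: less_induct)
  case less
  have fin: "finite S" "finite T" using bounded_matroid.finite_indep[OF M] less.prems T by auto
  show ?case
  proof (cases "card (T \<inter> A) = c")
    case True
    have "card T = card (T \<inter> A) + card (T - A)" using fin card_Int_Diff by blast
    then show ?thesis using True T by (intro bexI[of _ T]) auto
  next
    case False
    then have "S \<noteq> T" using less.prems(4) T(4) by auto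
    then obtain xs where xs: "min_neg_cyc (exch M N S (S - T) (T - S)) (\<lambda>_. - 1) xs"
      using shortest_exch_cyc_exists[OF M N less.prems(1-3) T(1-3)] by blast
    have c: "cyc (exch M N S (S - T) (T - S)) xs" "xs \<noteq> []"
      using xs by (auto simp: min_neg_cyc_def cyc_def)
    let ?S = "S - set xs \<union> (set xs - S)"
    show ?thesis
    proof (cases "c \<le> card (?S \<inter> A)")
      case True
      have XY: "S - T \<subseteq> S" "(T - S) \<inter> S = {}" by auto
      have b: "set xs \<subseteq> (S - T) \<union> (T - S)" "card (set xs \<inter> (S - T)) = card (set xs \<inter> (T - S))"
        using bipartite_cyc_balanced[OF c(1) _ exch_bipartite[of M N S "S - T" "T - S"]] by auto
      have "set xs \<inter> (S - T) \<noteq> {}"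
      proof
        assume "set xs \<inter> (S - T) = {}"
        then have "set xs \<inter> (T - S) = {}" using b(2) by simp
        then show False using b(1) c(2) \<open>set xs \<inter> (S - T) = {}\<close> by (cases xs) auto
      qed
      then have "?S - T \<subset> S - T" using b(1) by auto
      then have "card (?S - T) < card (S - T)" using fin by (intro psubset_card_mono) auto
      moreover have "?S \<in> M" "?S \<in> N"
        using exch_min_neg_cyc[OF M N less.prems(1-3) XY xs] by auto
      moreover have "card ?S = k" using card_exchanged[OF c(1) fin(1) XY] less.prems(3) by simp
      ultimately show ?thesis using less.hyps[of ?S] True by blast
    next
      case False
      then show ?thesis
        using crossing_shortest_exch_cyc[OF M N less.prems(1-3) _ _ xs less.prems(4)] by auto
    qed
  qed
qed

section \<open>Two-part partitions\<close>

text \<open>If no element of \<open>Y\<close> augments \<open>X\<close>, then \<open>X\<close> is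
  maximal in \<open>X \<union> Y\<close>. A maximal edge of \<open>X \<union> Y\<close> that
  contains \<open>Y\<close> has more elements than \<open>X\<close>, against the matroid
  condition.\<close>

lemma bounded_matroid_of_matroid:
  assumes V: "finite V" and C: "matroid V C"
  shows "bounded_matroid V C (card V)"
proof
  have sub: "X \<subseteq> V" if "X \<in> C" for X using C that by (auto simp: matroid_def complex_def)
  then show "X \<in> C \<Longrightarrow> X \<subseteq> V" "X \<in> C \<Longrightarrow> card X \<le> card V" for X
    using V by (auto intro: card_mono)
  show "finite V" "{} \<in> C" using V C by (auto simp: matroid_def)
  show down: "X \<in> C \<Longrightarrow> Y \<subseteq> X \<Longrightarrow> Y \<in> C" for X Y
  proof -
    have "\<forall>E\<in>C. \<forall>F. F \<subseteq> E \<longrightarrow> F \<in> C" using C by (simp add: matroid_def complex_def)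
    then show "X \<in> C \<Longrightarrow> Y \<subseteq> X \<Longrightarrow> Y \<in> C" by blast
  qed
  fix X Y assume XY: "X \<in> C" "Y \<in> C" "card X < card Y"
  show "\<exists>y\<in>Y - X. insert y X \<in> C"
  proof (rule ccontr)
    assume no: "\<not> ?thesis"
    let ?W = "X \<union> Y"
    have W: "?W \<subseteq> V" "finite ?W" using XY sub V finite_subset[of _ V] by auto
    have "maximal_in C ?W X"
      unfolding maximal_in_def
    proof (intro conjI ballI impI)
      fix Z assume Z: "Z \<in> C" "X \<subseteq> Z \<and> Z \<subseteq> ?W"
      show "Z = X"
      proof (rule ccontr)
        assume "Z \<noteq> X"
        then obtain z where "z \<in> Z - X" using Z by auto
        then show False using no Z down[of Z "insert z X"] by auto
      qed
    qed (use XY in auto)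
    let ?F = "{Z\<in>C. Y \<subseteq> Z \<and> Z \<subseteq> ?W}"
    have "finite ?F" using W(2) by (intro finite_subset[of ?F "Pow ?W"]) auto
    moreover have "Y \<in> ?F" using XY by auto
    ultimately have "\<exists>Z\<in>?F. Y \<subseteq> Z \<and> (\<forall>Z'\<in>?F. Z \<subseteq> Z' \<longrightarrow> Z = Z')"
      by (rule finite_has_maximal2)
    then obtain Z where Z: "Z \<in> ?F" "\<forall>Z'\<in>?F. Z \<subseteq> Z' \<longrightarrow> Z = Z'"
      by (elim bexE conjE)
    have "maximal_in C ?W Z"
      unfolding maximal_in_def
    proof (intro conjI ballI impI)
      show "Z \<in> C" "Z \<subseteq> ?W" using Z(1) by auto
      fix Z' assume "Z' \<in> C" "Z \<subseteq> Z' \<and> Z' \<subseteq> ?W"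
      then show "Z' = Z" using Z by auto
    qed
    moreover have "\<forall>W\<subseteq>V. \<forall>X Y. maximal_in C W X \<and> maximal_in C W Y \<longrightarrow> card X = card Y"
      using C by (simp add: matroid_def)
    ultimately have "card X = card Z" using \<open>maximal_in C ?W X\<close> W(1) by blast
    moreover have "card Y \<le> card Z" using Z(1) finite_subset[OF _ W(2), of Z] by (intro card_mono) auto
    ultimately show False using XY(3) by simp
  qed
qed

text \<open>\<open>0 < t\<close> forces \<open>z\<close> to be a finite positive number
  \<open>s\<close> with \<open>t = 1 / s\<close>. For nonempty \<open>L\<close> the rank is not
  zero, since the quotient bounded by \<open>s\<close> would be infinite; clearing denominators
  gives the claim.\<close>

lemma rank_ge_of_zeta:
  assumes V: "finite V" and C: "matroid V C" and t: "t = real_of_ereal (inverse z)" "0 < t"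
    and z: "zeta V C \<le> z" and L: "L \<subseteq> V"
  shows "\<exists>X\<in>C. X \<subseteq> L \<and> real (card L) * t \<le> real (card X)"
proof -
  have fin: "finite {E\<in>C. E \<subseteq> L}" "{E\<in>C. E \<subseteq> L} \<noteq> {}"
    using C finite_subset[OF L V] by (auto simp: matroid_def)
  then have "rank_on C L \<in> card ` {E\<in>C. E \<subseteq> L}" unfolding rank_on_def by (intro Max_in) auto
  then obtain X where X: "X \<in> C" "X \<subseteq> L" "card X = rank_on C L" by auto
  have "real (card L) * t \<le> real (rank_on C L)"
  proof (cases "L = {}")
    case False
    have "ereal (real (card L)) / ereal (real (rank_on C L)) \<le> zeta V C"
      unfolding zeta_def using V L False by (intro Max_ge) auto
    then have r: "ereal (real (card L)) / ereal (real (rank_on C L)) \<le> z" using z by simp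
    obtain s where s: "z = ereal s" "0 < s" "t = 1 / s"
      using t by (cases z) (auto simp: divide_inverse split: if_splits)
    have "0 < card L" using False finite_subset[OF L V] by (simp add: card_gt_0_iff)
    have "rank_on C L \<noteq> 0"
    proof
      assume "rank_on C L = 0"
      then have "ereal (real (card L)) / ereal (real (rank_on C L)) = \<infinity>"
        using \<open>0 < card L\<close> by (simp add: divide_ereal_def)
      then show False using r s by simp
    qed
    then have "real (card L) \<le> s * real (rank_on C L)" using r s by (simp add: field_simps)
    then show ?thesis using s(2) by (simp add: s(3) pos_divide_le_eq mult.commute)
  qed simp
  then show ?thesis using X by (intro bexI[of _ X]) auto
qed

theorem theorem2p7:
  fixes V :: "'a set" and P Q :: "'a set set" and A B :: "'a set"
  assumes "finite V"
    and "matroid V P" and "matroid V Q"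
    and "A \<union> B = V" and "A \<inter> B = {}"
  shows "\<exists>S \<in> P \<inter> Q.
           let \<zeta> = max (zeta V P) (zeta V Q);
               \<delta> = real_of_ereal (inverse \<zeta>) - 1 / real (card V)
           in int (card (S \<inter> A)) \<ge> \<lfloor>\<delta> * real (card A)\<rfloor> - 1
            \<and> int (card (S \<inter> B)) \<ge> \<lfloor>\<delta> * real (card B)\<rfloor> - 1"
proof -
  define n where "n = card V"
  define z where "z = max (zeta V P) (zeta V Q)"
  define t where "t = real_of_ereal (inverse z)"
  have "\<exists>I\<in>P \<inter> Q. \<lfloor>(t - 1 / real n) * real (card A)\<rfloor> - 1 \<le> int (card (I \<inter> A)) \<and>
      \<lfloor>(t - 1 / real n) * real (card B)\<rfloor> - 1 \<le> int (card (I \<inter> B))"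
  proof (cases "0 < t \<and> V \<noteq> {}")
    \<comment> \<open>This covers infinite \<open>z\<close>, where the inverse and hence
      \<open>t\<close> is zero. Both floors are at most zero, so the empty set serves.\<close>
    case False
    have nonpos: "\<lfloor>(t - 1 / real n) * real (card X)\<rfloor> \<le> 0" if "X \<subseteq> V" for X
    proof (cases "V = {}")
      case True
      then show ?thesis using that by simp
    next
      case nonempty: False
      then have "t \<le> 0" using False by auto
      moreover have "0 \<le> 1 / real n" by simp
      ultimately have "t - 1 / real n \<le> 0" by linarith
      then have "(t - 1 / real n) * real (card X) \<le> 0" by (intro mult_nonpos_nonneg) auto
      then show ?thesis by linarith
    qed
    have "A \<subseteq> V" "B \<subseteq> V" "{} \<in> P \<inter> Q" using assms by (auto simp: matroid_def)
    then show ?thesis using nonpos[of A] nonpos[of B] by (intro bexI[of _ "{}"]) auto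
  next
    case True
    then have n0: "0 < n" using assms(1) by (simp add: n_def card_gt_0_iff)
    note P = bounded_matroid_of_matroid[OF assms(1,2)] and Q = bounded_matroid_of_matroid[OF assms(1,3)]
    define k where "k = nat \<lfloor>real n * t\<rfloor>"
    have k: "real k \<le> real n * t" "real n * t - 1 \<le> real k"
      using True by (auto simp: k_def)
    have rank: "\<exists>X\<in>C. X \<subseteq> L \<and> card L * k \<le> n * card X"
      if C: "matroid V C" "zeta V C \<le> z" and L: "L \<subseteq> V" for C L
    proof -
      obtain X where X: "X \<in> C" "X \<subseteq> L" "real (card L) * t \<le> real (card X)"
        using rank_ge_of_zeta[OF assms(1) C(1) t_def _ C(2) L] True by blast
      have "real (card L) * real k \<le> real (card L) * (real n * t)"
        using k(1) by (intro mult_left_mono) auto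
      also have "\<dots> = real n * (real (card L) * t)" by simp
      also have "\<dots> \<le> real n * real (card X)" using X(3) by (intro mult_left_mono) auto
      finally have "real (card L * k) \<le> real (n * card X)" by simp
      then have "card L * k \<le> n * card X" by (simp only: of_nat_le_iff)
      then show ?thesis using X by blast
    qed
    have rankP: "\<And>L. L \<subseteq> V \<Longrightarrow> \<exists>X\<in>P. X \<subseteq> L \<and> card L * k \<le> n * card X"
      and rankQ: "\<And>L. L \<subseteq> V \<Longrightarrow> \<exists>X\<in>Q. X \<subseteq> L \<and> card L * k \<le> n * card X"
      using rank[OF assms(2)] rank[OF assms(3)] by (simp_all add: z_def)
    note heavy = common_basis_heavy_on[OF P Q n_def n0 _ rankP rankQ]
    obtain S where S: "S \<in> P" "S \<in> Q" "card S = k" "k * card A \<le> n * card (S \<inter> A)"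
      using heavy[of A] assms(4) by auto
    obtain T where T: "T \<in> P" "T \<in> Q" "card T = k" "k * card B \<le> n * card (T \<inter> B)"
      using heavy[of B] assms(4) by auto
    \<comment> \<open>The target for \<open>A\<close>, the floor of \<open>k |A| / n\<close>. It
      leaves \<open>k - c\<close> for \<open>B\<close>, which is at least
      \<open>k |B| / n\<close>.\<close>
    define c where "c = k * card A div n"
    have cA: "c \<le> card (S \<inter> A)"
    proof -
      have "c \<le> n * card (S \<inter> A) div n" unfolding c_def using S(4) by (rule div_le_mono)
      then show ?thesis using n0 by simp
    qed
    have fin: "finite A" "finite B" using assms(1) unfolding assms(4)[symmetric] by auto
    have nAB: "n = card A + card B" using card_Un_disjoint[OF fin assms(5)] assms(4) by (simp add: n_def)
    have "T \<subseteq> V" using bounded_matroid.subset_ground[OF P T(1)] .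
    then have "T - A = T \<inter> B" "finite T" using assms(1,4,5) by (auto dest: finite_subset)
    \<comment> \<open>Since \<open>T\<close> has \<open>k\<close> elements and
      \<open>n = |A| + |B|\<close>, being heavy on \<open>B\<close> makes \<open>T\<close> light on
      \<open>A\<close>.\<close>
    then have "k = card (T \<inter> A) + card (T \<inter> B)" using T(3) card_Int_Diff[of T A] by simp
    then have "n * card (T \<inter> A) + n * card (T \<inter> B) = k * card A + k * card B"
      unfolding nAB by (simp add: algebra_simps)
    then have "n * card (T \<inter> A) \<le> k * card A" using T(4) by linarith
    then have cT: "card (T \<inter> A) \<le> c"
      unfolding c_def using n0 by (simp add: less_eq_div_iff_mult_less_eq mult.commute)
    \<comment> \<open>Truncation to size \<open>k\<close> makes \<open>S\<close> and
      \<open>T\<close> bases of both matroids.\<close>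
    obtain I where I: "I \<in> P" "I \<in> Q" "c \<le> card (I \<inter> A) + 1" "k \<le> card (I - A) + c"
      using balanced_common_independent[OF bounded_matroid_truncate[OF P] bounded_matroid_truncate[OF Q],
          of S k c A T] S T cA cT by auto
    have "I - A = I \<inter> B" using bounded_matroid.subset_ground[OF P I(1)] assms by auto
    then have IB: "k \<le> card (I \<inter> B) + c" using I(4) by simp
    have le: "(t - 1 / real n) * real (card X) \<le> real k * real (card X) / real n" for X
    proof -
      have "t \<le> (real k + 1) / real n" using k(2) n0 by (simp add: pos_le_divide_eq mult.commute)
      then have "t - 1 / real n \<le> real k / real n" by (simp add: add_divide_distrib)
      then have "(t - 1 / real n) * real (card X) \<le> real k / real n * real (card X)"
        by (intro mult_right_mono) auto
      then show ?thesis by simp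
    qed
    have "\<lfloor>(t - 1 / real n) * real (card A)\<rfloor> \<le> \<lfloor>real (k * card A) / real n\<rfloor>"
      using le[of A] by (intro floor_mono) simp
    also have "\<dots> = int c" unfolding c_def by (rule floor_divide_of_nat_eq)
    finally have 1: "\<lfloor>(t - 1 / real n) * real (card A)\<rfloor> \<le> int c" .
    have "c * n \<le> k * card A" by (simp add: c_def)
    then have "real (c * n) \<le> real (k * card A)" by (simp only: of_nat_le_iff)
    then have "real c * real n \<le> real k * real (card A)" by simp
    then have "real k * real (card B) \<le> (real k - real c) * real n"
      unfolding nAB by (simp add: algebra_simps)
    then have "real k * real (card B) / real n \<le> real k - real c"
      using n0 by (simp add: pos_divide_le_eq)
    then have "(t - 1 / real n) * real (card B) \<le> real_of_int (int k - int c)"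
      using le[of B] by simp
    then have "\<lfloor>(t - 1 / real n) * real (card B)\<rfloor> \<le> \<lfloor>real_of_int (int k - int c)\<rfloor>"
      by (rule floor_mono)
    then have "\<lfloor>(t - 1 / real n) * real (card B)\<rfloor> \<le> int k - int c" by (simp only: floor_of_int)
    then show ?thesis using 1 I IB by (intro bexI[of _ I]) auto
  qed
  then show ?thesis unfolding Let_def t_def z_def n_def .
qed

end
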